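(* Suppose that $F\in\operatorname{dom}(D)$ and $G\in\operatorname{dom}(L)$. Then, $$\mathbb{E}\bigl[F\,LG\bigr]=-\mathbb{E}\bigl[\Gamma_0(F,G)\bigr].$$
   Context: $\mathbb{N}=\{1,2,\ldots\}$. Let $(E_n,\mathcal{B}_n,\mu_n)$, $n\in\mathbb{N}$, be arbitrary probability spaces with product $(E,\mathcal{B},\mu)$. On a probability space $(\Omega,\mathcal{A},\mathbb{P})$ let $\mathbb{X}=(X_n)_{n\in\mathbb{N}}$ and $\mathbb{X}'=(X_n')_{n\in\mathbb{N}}$ be two independent $E$-valued random sequences, each with distribution $\mu$. For $k\in\mathbb{N}$, $\mathbb{X}^{(k)}$ denotes the sequence $\mathbb{X}$ with its $k$-th coordinate $X_k$ replaced by $X_k'$. Let $\mathcal{F}=\sigma(\mathbb{X})$, $\mathbb{P}_{\mathcal{F}}$ the restriction of $\mathbb{P}$ to $\mathcal{F}$, $L^2_{\mathbb{X}}=L^2(\Omega,\mathcal{F},\mathbb{P})$ (real-valued), $\kappa$ the counting measure on $\mathbb{N}$, and $\mathcal{G}_k=\sigma(X_j,j\neq k)$. A representative of $F\in L^2_{\mathbb{X}}$ is a function $f\in L^2(\mu)$ with $F=f(\mathbb{X})$ (it exists and is $\mu$-a.s. unique). Malliavin operators: for $F\in L^2_{\mathbb{X}}$, $D_kF:=F-\mathbb{E}[F\,|\,\mathcal{G}_k]$. On the dense subspace $\mathcal{S}\subseteq L^2_{\mathbb{X}}$ of random variables that are $\sigma(X_1,\dotsc,X_n)$-measurable for some $n$,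 define $DF:=(D_kF)_{k\in\mathbb{N}}\in L^2(\kappa\otimes\mathbb{P}_{\mathcal{F}})$. This operator is closable; its closure is again denoted by $D$, with domain $\operatorname{dom}(D)\subseteq L^2_{\mathbb{X}}$, and $DF=(D_kF)_{k\in\mathbb{N}}$ for all $F\in\operatorname{dom}(D)$. The divergence $\delta$ is the adjoint of $D$: $\operatorname{dom}(\delta)$ is the set of all $U=(U_k)_{k}\in L^2(\kappa\otimes\mathbb{P}_{\mathcal{F}})$ for which there is $C<\infty$ with $\bigl|\sum_{k=1}^\infty\mathbb{E}[D_kF\,U_k]\bigr|\leq C\|F\|_2$ for all $F\in\operatorname{dom}(D)$, and $\mathbb{E}[F\,\delta U]=\sum_{k=1}^\infty\mathbb{E}[D_kF\,U_k]$ for all such $F$. The Ornstein-Uhlenbeck generator $L$ has domain $\operatorname{dom}(L):=\{F\in\operatorname{dom}(D): DF\in\operatorname{dom}(\delta)\}$ and $LF:=-\delta DF$. For $F,G\in\operatorname{dom}(D)$ with respective representatives $f,g\in L^2(\mu)$, $$\Gamma_0(F,G):=\frac12\sum_{k=1}^\infty\mathbb{E}\Bigl[\bigl(f(\mathbb{X}^{(k)})-f(\mathbb{X})\bigr)\bigl(g(\mathbb{X}^{(k)})-g(\mathbb{X})\bigr)\,\Big|\,\mathbb{X}\Bigr],$$ which is a well-defined element of $L^1(\mathbb{P})$ (the sum of the $L^1$-norms of the summands is finite). *)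

theory Defs
  imports "HOL-Probability.Probability"
begin

text \<open>
  Conventions. Sequences are indexed by \<open>nat\<close>, so the index \<open>k = 1, 2, \<dots>\<close> of the mathematics
  is \<open>0, 1, \<dots>\<close> here. The \<open>n\<close>-th factor \<open>(E\<^sub>n, B\<^sub>n, \<mu>\<^sub>n)\<close> is \<open>M n\<close>, and \<open>\<mu>\<close> is
  \<open>PiM UNIV M\<close>. Elements of \<open>L\<^sup>2\<close> are represented by functions; operators whose values are only
  determined almost everywhere pick one version by Hilbert choice.
\<close>

definition L2_space :: "'b measure \<Rightarrow> ('b \<Rightarrow> real) set" where
  "L2_space N = {f \<in> borel_measurable N. integrable N (\<lambda>x. (f x)\<^sup>2)}"

definition L2_norm :: "'b measure \<Rightarrow> ('b \<Rightarrow> real) \<Rightarrow> real" where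
  "L2_norm N f = sqrt (\<integral>x. (f x)\<^sup>2 \<partial>N)"

definition sigma_X :: "(nat \<Rightarrow> 'a measure) \<Rightarrow> 'w measure \<Rightarrow> ('w \<Rightarrow> nat \<Rightarrow> 'a) \<Rightarrow> 'w measure" where
  "sigma_X M P X = vimage_algebra (space P) X (PiM UNIV M)"

definition sigma_coords ::
    "(nat \<Rightarrow> 'a measure) \<Rightarrow> 'w measure \<Rightarrow> ('w \<Rightarrow> nat \<Rightarrow> 'a) \<Rightarrow> nat set \<Rightarrow> 'w measure" where
  "sigma_coords M P X J =
     sigma (space P) (\<Union>j\<in>J. {(\<lambda>\<omega>. X \<omega> j) -` A \<inter> space P | A. A \<in> sets (M j)})"

definition P_X :: "(nat \<Rightarrow> 'a measure) \<Rightarrow> 'w measure \<Rightarrow> ('w \<Rightarrow> nat \<Rightarrow> 'a) \<Rightarrow> 'w measure" where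
  "P_X M P X = restr_to_subalg P (sigma_X M P X)"

definition kappa_P_X ::
    "(nat \<Rightarrow> 'a measure) \<Rightarrow> 'w measure \<Rightarrow> ('w \<Rightarrow> nat \<Rightarrow> 'a) \<Rightarrow> (nat \<times> 'w) measure" where
  "kappa_P_X M P X = count_space UNIV \<Otimes>\<^sub>M P_X M P X"

definition D_coord ::
    "(nat \<Rightarrow> 'a measure) \<Rightarrow> 'w measure \<Rightarrow> ('w \<Rightarrow> nat \<Rightarrow> 'a) \<Rightarrow> nat \<Rightarrow> ('w \<Rightarrow> real) \<Rightarrow> 'w \<Rightarrow> real" where
  "D_coord M P X k F = (\<lambda>\<omega>. F \<omega> - real_cond_exp P (sigma_coords M P X (- {k})) F \<omega>)"

text \<open>
  The core \<open>S\<close>. With indices starting at \<open>0\<close>, the sets \<open>{..n}\<close> are exactly the nonempty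
  initial segments.
\<close>
definition D_core ::
    "(nat \<Rightarrow> 'a measure) \<Rightarrow> 'w measure \<Rightarrow> ('w \<Rightarrow> nat \<Rightarrow> 'a) \<Rightarrow> ('w \<Rightarrow> real) set" where
  "D_core M P X =
     {F \<in> L2_space (P_X M P X). \<exists>n. F \<in> borel_measurable (sigma_coords M P X {..n})}"

text \<open>The closure, in \<open>L\<^sup>2 \<times> L\<^sup>2\<close>, of the graph of \<open>F \<mapsto> (D\<^sub>k F)\<^sub>k\<close> on the core\<close>
definition D_graph ::
    "(nat \<Rightarrow> 'a measure) \<Rightarrow> 'w measure \<Rightarrow> ('w \<Rightarrow> nat \<Rightarrow> 'a) \<Rightarrow>
     (('w \<Rightarrow> real) \<times> (nat \<times> 'w \<Rightarrow> real)) set" where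
  "D_graph M P X =
     {(F, U). F \<in> L2_space (P_X M P X) \<and> U \<in> L2_space (kappa_P_X M P X) \<and>
        (\<exists>S. (\<forall>m. S m \<in> D_core M P X) \<and>
             (\<lambda>m. L2_norm (P_X M P X) (\<lambda>\<omega>. S m \<omega> - F \<omega>)) \<longlonglongrightarrow> 0 \<and>
             (\<lambda>m. L2_norm (kappa_P_X M P X) (\<lambda>(k, \<omega>). D_coord M P X k (S m) \<omega> - U (k, \<omega>)))
               \<longlonglongrightarrow> 0)}"

definition dom_D ::
    "(nat \<Rightarrow> 'a measure) \<Rightarrow> 'w measure \<Rightarrow> ('w \<Rightarrow> nat \<Rightarrow> 'a) \<Rightarrow> ('w \<Rightarrow> real) set" where
  "dom_D M P X = {F. \<exists>U. (F, U) \<in> D_graph M P X}"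

definition malliavin_D ::
    "(nat \<Rightarrow> 'a measure) \<Rightarrow> 'w measure \<Rightarrow> ('w \<Rightarrow> nat \<Rightarrow> 'a) \<Rightarrow>
     ('w \<Rightarrow> real) \<Rightarrow> nat \<times> 'w \<Rightarrow> real" where
  "malliavin_D M P X F = (SOME U. (F, U) \<in> D_graph M P X)"

text \<open>The pairing \<open>\<Sum>\<^sub>k E[D\<^sub>k F U\<^sub>k]\<close>; it converges absolutely for \<open>F \<in> dom D\<close> and \<open>U \<in> L\<^sup>2\<close>.\<close>
definition D_pairing ::
    "(nat \<Rightarrow> 'a measure) \<Rightarrow> 'w measure \<Rightarrow> ('w \<Rightarrow> nat \<Rightarrow> 'a) \<Rightarrow>
     ('w \<Rightarrow> real) \<Rightarrow> (nat \<times> 'w \<Rightarrow> real) \<Rightarrow> real" where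
  "D_pairing M P X F U = (\<Sum>k. \<integral>\<omega>. D_coord M P X k F \<omega> * U (k, \<omega>) \<partial>P)"

definition dom_delta ::
    "(nat \<Rightarrow> 'a measure) \<Rightarrow> 'w measure \<Rightarrow> ('w \<Rightarrow> nat \<Rightarrow> 'a) \<Rightarrow> (nat \<times> 'w \<Rightarrow> real) set" where
  "dom_delta M P X =
     {U \<in> L2_space (kappa_P_X M P X).
        \<exists>C::real. \<forall>F \<in> dom_D M P X. \<bar>D_pairing M P X F U\<bar> \<le> C * L2_norm (P_X M P X) F}"

definition divergence ::
    "(nat \<Rightarrow> 'a measure) \<Rightarrow> 'w measure \<Rightarrow> ('w \<Rightarrow> nat \<Rightarrow> 'a) \<Rightarrow>
     (nat \<times> 'w \<Rightarrow> real) \<Rightarrow> 'w \<Rightarrow> real" where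
  "divergence M P X U =
     (SOME V. V \<in> L2_space (P_X M P X) \<and>
        (\<forall>F \<in> dom_D M P X. (\<integral>\<omega>. F \<omega> * V \<omega> \<partial>P) = D_pairing M P X F U))"

definition dom_L ::
    "(nat \<Rightarrow> 'a measure) \<Rightarrow> 'w measure \<Rightarrow> ('w \<Rightarrow> nat \<Rightarrow> 'a) \<Rightarrow> ('w \<Rightarrow> real) set" where
  "dom_L M P X = {F \<in> dom_D M P X. malliavin_D M P X F \<in> dom_delta M P X}"

definition OU_generator ::
    "(nat \<Rightarrow> 'a measure) \<Rightarrow> 'w measure \<Rightarrow> ('w \<Rightarrow> nat \<Rightarrow> 'a) \<Rightarrow>
     ('w \<Rightarrow> real) \<Rightarrow> 'w \<Rightarrow> real" where
  "OU_generator M P X F = (\<lambda>\<omega>. - divergence M P X (malliavin_D M P X F) \<omega>)"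

definition is_representative ::
    "(nat \<Rightarrow> 'a measure) \<Rightarrow> 'w measure \<Rightarrow> ('w \<Rightarrow> nat \<Rightarrow> 'a) \<Rightarrow>
     ('w \<Rightarrow> real) \<Rightarrow> ((nat \<Rightarrow> 'a) \<Rightarrow> real) \<Rightarrow> bool" where
  "is_representative M P X F f \<longleftrightarrow>
     f \<in> L2_space (PiM UNIV M) \<and> (AE \<omega> in P. F \<omega> = f (X \<omega>))"

definition representative ::
    "(nat \<Rightarrow> 'a measure) \<Rightarrow> 'w measure \<Rightarrow> ('w \<Rightarrow> nat \<Rightarrow> 'a) \<Rightarrow>
     ('w \<Rightarrow> real) \<Rightarrow> (nat \<Rightarrow> 'a) \<Rightarrow> real" where
  "representative M P X F = (SOME f. is_representative M P X F f)"

definition replace_coord ::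
    "('w \<Rightarrow> nat \<Rightarrow> 'a) \<Rightarrow> ('w \<Rightarrow> nat \<Rightarrow> 'a) \<Rightarrow> nat \<Rightarrow> 'w \<Rightarrow> nat \<Rightarrow> 'a" where
  "replace_coord X X' k \<omega> = (X \<omega>)(k := X' \<omega> k)"

text \<open>
  The series converges absolutely almost surely for \<open>F, G \<in> dom D\<close>, since the sum of the
  \<open>L\<^sup>1\<close>-norms of its summands is finite.
\<close>
definition Gamma0 ::
    "(nat \<Rightarrow> 'a measure) \<Rightarrow> 'w measure \<Rightarrow> ('w \<Rightarrow> nat \<Rightarrow> 'a) \<Rightarrow> ('w \<Rightarrow> nat \<Rightarrow> 'a) \<Rightarrow>
     ('w \<Rightarrow> real) \<Rightarrow> ('w \<Rightarrow> real) \<Rightarrow> 'w \<Rightarrow> real" where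
  "Gamma0 M P X X' F G = (\<lambda>\<omega>.
     let f = representative M P X F; g = representative M P X G in
     1 / 2 * (\<Sum>k. real_cond_exp P (sigma_X M P X)
       (\<lambda>\<omega>. (f (replace_coord X X' k \<omega>) - f (X \<omega>)) * (g (replace_coord X X' k \<omega>) - g (X \<omega>))) \<omega>))"

end

theory Submission
  imports Defs
begin

text \<open>
  The closure of \<open>D\<close> acts coordinatewise as \<open>F - E[F | G\<^sub>k]\<close>, so duality gives
  \<open>E[F LG] = - \<Sum>\<^sub>k E[D\<^sub>k F D\<^sub>k G]\<close>; the existence of \<open>\<delta>DG\<close> is a Riesz representation on the
  subspace \<open>dom D\<close> of \<open>L\<^sup>2\<close>. Given \<open>G\<^sub>k\<close>, the sequences \<open>X\<close> and \<open>X\<^sup>(\<^sup>k\<^sup>)\<close> are independent with the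
  same law, whence
  \<open>E[(f(X\<^sup>(\<^sup>k\<^sup>)) - f(X)) (g(X\<^sup>(\<^sup>k\<^sup>)) - g(X))] = 2 E[FG] - 2 E[E[F | G\<^sub>k] E[G | G\<^sub>k]] = 2 E[D\<^sub>k F D\<^sub>k G]\<close>.
  Summing over \<open>k\<close>, with absolute convergence from \<open>\<Sum>\<^sub>k E[(D\<^sub>k F)\<^sup>2] < \<infinity>\<close>, gives the claim.
\<close>

section \<open>Square-integrable functions\<close>

text \<open>\<open>malliavin_D\<close>, \<open>divergence\<close> and \<open>representative\<close>
  are Hilbert choices, so nothing is known about their values until the defining property is shown
  to be satisfiable. The Riesz theorem and the Doob-Dynkin factorisation supply these witnesses; the
  chosen versions are then handled only almost everywhere. The coordinate formula for the closure
  also yields closability: any two \<open>U\<close> paired with the same \<open>F\<close> in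
  \<open>D_graph\<close> agree almost everywhere in each coordinate. A second obstacle is that
  integrals of non-integrable functions and sums of divergent series still denote some value.
  Membership in \<open>L2_space\<close> and summability are therefore secured before a norm, a
  pairing or a series is manipulated. The factor 1/2 in \<open>Gamma0\<close> compensates a double
  count: F and its resampled version each contribute the conditional variance of F given G_k to the
  mean square of their difference.\<close>

lemma L2_spaceI: "f \<in> borel_measurable N \<Longrightarrow> integrable N (\<lambda>x. (f x)\<^sup>2) \<Longrightarrow> f \<in> L2_space N"
  by (simp add: L2_space_def)

lemma L2_space_measurable: "f \<in> L2_space N \<Longrightarrow> f \<in> borel_measurable N"
  and L2_space_integrable_square: "f \<in> L2_space N \<Longrightarrow> integrable N (\<lambda>x. (f x)\<^sup>2)"
  by (simp_all add: L2_space_def)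

lemma L2_norm_square: "(L2_norm N f)\<^sup>2 = (\<integral>x. (f x)\<^sup>2 \<partial>N)"
  by (simp add: L2_norm_def)

text \<open>Squared norms expand by bilinearity, so limits are computed with them. Squaring and
  \<open>sqrt\<close> undo each other for every \<open>f\<close>, because the integral of a square
  is nonnegative even in the non-integrable case.\<close>

lemma L2_norm_tendsto_0_iff:
  "(\<lambda>m. L2_norm N (f m)) \<longlonglongrightarrow> 0 \<longleftrightarrow> (\<lambda>m. \<integral>x. (f m x)\<^sup>2 \<partial>N) \<longlonglongrightarrow> 0"
proof
  assume "(\<lambda>m. L2_norm N (f m)) \<longlonglongrightarrow> 0"
  from tendsto_power[OF this, of 2] show "(\<lambda>m. \<integral>x. (f m x)\<^sup>2 \<partial>N) \<longlonglongrightarrow> 0"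
    by (simp add: L2_norm_square)
next
  assume "(\<lambda>m. \<integral>x. (f m x)\<^sup>2 \<partial>N) \<longlonglongrightarrow> 0"
  from tendsto_real_sqrt[OF this] show "(\<lambda>m. L2_norm N (f m)) \<longlonglongrightarrow> 0"
    by (simp add: L2_norm_def)
qed

lemma abs_mult_le_sum_squares: "\<bar>a * b\<bar> \<le> a\<^sup>2 + b\<^sup>2" for a b :: real
proof -
  have "2 * (\<bar>a\<bar> * \<bar>b\<bar>) \<le> a\<^sup>2 + b\<^sup>2"
    using sum_squares_bound[of "\<bar>a\<bar>" "\<bar>b\<bar>"] by simp
  moreover have "0 \<le> \<bar>a\<bar> * \<bar>b\<bar>"
    by simp
  ultimately show ?thesis
    unfolding abs_mult by linarith
qed

lemma L2_space_integrable_mult: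
  assumes "f \<in> L2_space N" "g \<in> L2_space N"
  shows "integrable N (\<lambda>x. f x * g x)"
proof (rule Bochner_Integration.integrable_bound)
  show "integrable N (\<lambda>x. (f x)\<^sup>2 + (g x)\<^sup>2)"
    using assms by (auto dest: L2_space_integrable_square)
  show "(\<lambda>x. f x * g x) \<in> borel_measurable N"
    using assms[THEN L2_space_measurable] by measurable
  show "AE x in N. norm (f x * g x) \<le> norm ((f x)\<^sup>2 + (g x)\<^sup>2)"
    using abs_mult_le_sum_squares by simp
qed

lemma L2_space_lincomb:
  assumes "f \<in> L2_space N" "g \<in> L2_space N"
  shows "(\<lambda>x. a * f x + b * g x) \<in> L2_space N"
proof (rule L2_spaceI)
  show "(\<lambda>x. a * f x + b * g x) \<in> borel_measurable N"
    using assms[THEN L2_space_measurable] by measurable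
  have "integrable N (\<lambda>x. a\<^sup>2 * (f x)\<^sup>2 + 2 * a * b * (f x * g x) + b\<^sup>2 * (g x)\<^sup>2)"
    using assms
    by (intro Bochner_Integration.integrable_add integrable_mult_right L2_space_integrable_mult L2_space_integrable_square)
  then show "integrable N (\<lambda>x. (a * f x + b * g x)\<^sup>2)"
    by (rule back_subst[where P="integrable N"]) (auto simp: power2_eq_square algebra_simps)
qed

lemma L2_space_diff:
  assumes "f \<in> L2_space N" "g \<in> L2_space N"
  shows "(\<lambda>x. f x - g x) \<in> L2_space N"
  using L2_space_lincomb[OF assms, of 1 "-1"] by simp

lemma integral_square_lincomb:
  assumes "f \<in> L2_space N" "g \<in> L2_space N"
  shows "(\<integral>x. (a * f x + b * g x)\<^sup>2 \<partial>N) =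
    a\<^sup>2 * (\<integral>x. (f x)\<^sup>2 \<partial>N) + 2 * a * b * (\<integral>x. f x * g x \<partial>N) + b\<^sup>2 * (\<integral>x. (g x)\<^sup>2 \<partial>N)"
proof -
  have "(\<integral>x. (a * f x + b * g x)\<^sup>2 \<partial>N) =
      (\<integral>x. a\<^sup>2 * (f x)\<^sup>2 + 2 * a * b * (f x * g x) + b\<^sup>2 * (g x)\<^sup>2 \<partial>N)"
    by (intro Bochner_Integration.integral_cong) (auto simp: power2_eq_square algebra_simps)
  also have "\<dots> = a\<^sup>2 * (\<integral>x. (f x)\<^sup>2 \<partial>N) + 2 * a * b * (\<integral>x. f x * g x \<partial>N) + b\<^sup>2 * (\<integral>x. (g x)\<^sup>2 \<partial>N)"
    using L2_space_integrable_mult[OF assms] assms[THEN L2_space_integrable_square] by simp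
  finally show ?thesis .
qed

lemma integral_square_diff:
  assumes "f \<in> L2_space N" "g \<in> L2_space N"
  shows "(\<integral>x. (f x - g x)\<^sup>2 \<partial>N) =
    (\<integral>x. (f x)\<^sup>2 \<partial>N) - 2 * (\<integral>x. f x * g x \<partial>N) + (\<integral>x. (g x)\<^sup>2 \<partial>N)"
  using integral_square_lincomb[OF assms, of 1 "-1"] by simp

text \<open>Adding the nonnegative integral of (a f - b g)^2 cancels the mixed term. It serves as a
  triangle inequality for squared norms.\<close>

lemma integral_square_lincomb_le:
  assumes "f \<in> L2_space N" "g \<in> L2_space N"
  shows "(\<integral>x. (a * f x + b * g x)\<^sup>2 \<partial>N) \<le>
    2 * a\<^sup>2 * (\<integral>x. (f x)\<^sup>2 \<partial>N) + 2 * b\<^sup>2 * (\<integral>x. (g x)\<^sup>2 \<partial>N)"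
proof -
  have "0 \<le> (\<integral>x. (a * f x + (- b) * g x)\<^sup>2 \<partial>N)"
    by simp
  then show ?thesis
    unfolding integral_square_lincomb[OF assms] by simp
qed

lemma L2_Cauchy_Schwarz:
  assumes "f \<in> L2_space N" "g \<in> L2_space N"
  shows "\<bar>\<integral>x. f x * g x \<partial>N\<bar> \<le> L2_norm N f * L2_norm N g"
proof -
  let ?A = "\<integral>x. (f x)\<^sup>2 \<partial>N" and ?B = "\<integral>x. f x * g x \<partial>N" and ?C = "\<integral>x. (g x)\<^sup>2 \<partial>N"
  have nonneg: "0 \<le> a\<^sup>2 * ?A + 2 * a * b * ?B + b\<^sup>2 * ?C" for a b
    unfolding integral_square_lincomb[OF assms, symmetric] by simp
  have "?B\<^sup>2 \<le> ?A * ?C"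
  proof (cases "?C = 0")
    case False
    then have "0 < ?C" by (simp add: less_le)
    \<comment> \<open>The quadratic form at a = C, b = -B; dividing by C > 0 leaves the discriminant
      bound.\<close>
    moreover have "0 \<le> ?C * (?A * ?C - ?B\<^sup>2)"
      using nonneg[of ?C "- ?B"] by (simp add: power2_eq_square algebra_simps)
    ultimately show ?thesis
      by (simp add: zero_le_mult_iff)
  next
    case True
    have "?B = 0"
    proof (rule ccontr)
      assume "?B \<noteq> 0"
      \<comment> \<open>With C = 0 the form is affine in b, and at a = 1 the chosen b gives A - (A +
        1) = -1.\<close>
      then show False
        using nonneg[of 1 "- (?A + 1) / (2 * ?B)"] True by (simp add: field_simps)
    qed
    then show ?thesis by simp
  qed
  then have "sqrt (?B\<^sup>2) \<le> sqrt (?A * ?C)"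
    by (rule real_sqrt_le_mono)
  then show ?thesis
    by (simp add: L2_norm_def real_sqrt_mult)
qed

lemma abs_integral_mult_le:
  assumes "f \<in> L2_space N" "g \<in> L2_space N"
  shows "(\<integral>x. \<bar>f x * g x\<bar> \<partial>N) \<le> (\<integral>x. (f x)\<^sup>2 \<partial>N) + (\<integral>x. (g x)\<^sup>2 \<partial>N)"
proof -
  have "(\<integral>x. \<bar>f x * g x\<bar> \<partial>N) \<le> (\<integral>x. (f x)\<^sup>2 + (g x)\<^sup>2 \<partial>N)"
    using L2_space_integrable_mult[OF assms] assms[THEN L2_space_integrable_square]
      abs_mult_le_sum_squares
    by (intro integral_mono) auto
  then show ?thesis
    using assms[THEN L2_space_integrable_square] by simp
qed

section \<open>Limits in L2 and the representation of bounded functionals\<close>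

lemma L2_inner_tendsto:
  assumes "\<And>n. f n \<in> L2_space N" "f' \<in> L2_space N" "g \<in> L2_space N"
    and "(\<lambda>n. \<integral>x. (f n x - f' x)\<^sup>2 \<partial>N) \<longlonglongrightarrow> 0"
  shows "(\<lambda>n. \<integral>x. f n x * g x \<partial>N) \<longlonglongrightarrow> (\<integral>x. f' x * g x \<partial>N)"
proof -
  have "(\<lambda>n. (\<integral>x. f n x * g x \<partial>N) - (\<integral>x. f' x * g x \<partial>N)) \<longlonglongrightarrow> 0"
  proof (rule Lim_null_comparison)
    have "(\<lambda>n. L2_norm N (\<lambda>x. f n x - f' x)) \<longlonglongrightarrow> 0"
      using assms(4) by (simp add: L2_norm_tendsto_0_iff)
    then show "(\<lambda>n. L2_norm N (\<lambda>x. f n x - f' x) * L2_norm N g) \<longlonglongrightarrow> 0"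
      by (rule tendsto_mult_left_zero)
    show "\<forall>\<^sub>F n in sequentially. norm ((\<integral>x. f n x * g x \<partial>N) - (\<integral>x. f' x * g x \<partial>N)) \<le>
        L2_norm N (\<lambda>x. f n x - f' x) * L2_norm N g"
    proof (rule always_eventually, rule allI)
      fix n
      have "(\<integral>x. f n x * g x \<partial>N) - (\<integral>x. f' x * g x \<partial>N) = (\<integral>x. (f n x - f' x) * g x \<partial>N)"
        using assms(1-3) by (simp add: left_diff_distrib L2_space_integrable_mult)
      then show "norm ((\<integral>x. f n x * g x \<partial>N) - (\<integral>x. f' x * g x \<partial>N)) \<le>
        L2_norm N (\<lambda>x. f n x - f' x) * L2_norm N g"
        using L2_Cauchy_Schwarz[OF L2_space_diff[OF assms(1,2)] assms(3)] by simp
    qed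
  qed
  then show ?thesis
    by (simp add: LIM_zero_iff)
qed

text \<open>By Tonelli the sum of absolute values has a finite integral, so it is finite almost
  everywhere. Both the completeness of L2 and the series in \<open>Gamma0\<close> rest on
  this.\<close>

lemma AE_summable_abs:
  fixes f :: "nat \<Rightarrow> 'a \<Rightarrow> real"
  assumes int: "\<And>n. integrable N (f n)" and sum: "summable (\<lambda>n. \<integral>x. \<bar>f n x\<bar> \<partial>N)"
  shows "AE x in N. summable (\<lambda>n. \<bar>f n x\<bar>)"
proof -
  have [measurable]: "f n \<in> borel_measurable N" for n
    using int by (rule borel_measurable_integrable)
  have "(\<integral>\<^sup>+x. (\<Sum>n. ennreal \<bar>f n x\<bar>) \<partial>N) = (\<Sum>n. \<integral>\<^sup>+x. ennreal \<bar>f n x\<bar> \<partial>N)"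
    by (rule nn_integral_suminf) measurable
  also have "\<dots> = (\<Sum>n. ennreal (\<integral>x. \<bar>f n x\<bar> \<partial>N))"
    using int by (simp add: nn_integral_eq_integral)
  also have "\<dots> = ennreal (\<Sum>n. \<integral>x. \<bar>f n x\<bar> \<partial>N)"
    using sum by (intro suminf_ennreal2) auto
  finally have "AE x in N. (\<Sum>n. ennreal \<bar>f n x\<bar>) \<noteq> \<infinity>"
    by (intro nn_integral_PInf_AE) auto
  then show ?thesis
    by eventually_elim (auto intro: summable_suminf_not_top)
qed

lemma (in finite_measure) L2_space_integrable:
  "f \<in> L2_space M \<Longrightarrow> integrable M f"
  by (rule square_integrable_imp_integrable) (auto simp: L2_space_def)

text \<open>
  The rate makes the increments summable in \<open>L\<^sup>1\<close>, so the sequence itself converges almost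
  everywhere and no subsequence is needed; Fatou identifies the limit in \<open>L\<^sup>2\<close>.
\<close>
lemma (in finite_measure) L2_rapid_Cauchy_limit:
  fixes f :: "nat \<Rightarrow> 'a \<Rightarrow> real"
  assumes f: "\<And>n. f n \<in> L2_space M"
    and Cauchy: "\<And>n m. n \<le> m \<Longrightarrow> (\<integral>x. (f n x - f m x)\<^sup>2 \<partial>M) \<le> c * (1/4)^n"
  obtains g where "g \<in> L2_space M" "(\<lambda>n. \<integral>x. (f n x - g x)\<^sup>2 \<partial>M) \<longlonglongrightarrow> 0"
proof -
  have [measurable]: "f n \<in> borel_measurable M" for n
    using f by (rule L2_space_measurable)
  have d: "(\<lambda>x. f n x - f m x) \<in> L2_space M" for n m
    using f by (intro L2_space_diff)
  define K where "K = (c + measure M (space M)) / 2"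
  have incr: "(\<integral>x. \<bar>f (Suc n) x - f n x\<bar> \<partial>M) \<le> K * (1/2)^n" for n
  proof -
    \<comment> \<open>AM-GM with weight 2^n: a mean square of order 4^-n and the constant term then
      both contribute order 2^-n, which is summable.\<close>
    have pw: "\<bar>t\<bar> \<le> (2^n * t\<^sup>2 + (1/2)^n) / 2" for t :: real
    proof -
      have "0 \<le> (1/2)^n * (2^n * \<bar>t\<bar> - 1)\<^sup>2"
        by simp
      also have "\<dots> = ((1/2)^n * 2^n) * (2^n * t\<^sup>2) - 2 * ((1/2)^n * 2^n) * \<bar>t\<bar> + (1/2)^n"
        by (simp add: power2_eq_square algebra_simps)
      also have "(1/2)^n * 2^n = (1::real)"
        by (simp add: power_divide)
      finally show ?thesis by simp
    qed
    have "(\<integral>x. \<bar>f (Suc n) x - f n x\<bar> \<partial>M) \<le> (\<integral>x. (2^n * (f n x - f (Suc n) x)\<^sup>2 + (1/2)^n) / 2 \<partial>M)"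
      using L2_space_integrable[OF d] L2_space_integrable_square[OF d] pw
      by (intro integral_mono) (auto simp: abs_minus_commute)
    also have "\<dots> = (2^n * (\<integral>x. (f n x - f (Suc n) x)\<^sup>2 \<partial>M) + (1/2)^n * measure M (space M)) / 2"
      using L2_space_integrable_square[OF d] by simp
    also have "\<dots> \<le> (2^n * (c * (1/4)^n) + (1/2)^n * measure M (space M)) / 2"
      using Cauchy[of n "Suc n"] by simp
    also have "2^n * (c * (1/4)^n) = c * (1/2)^n"
      by (simp add: power_divide field_simps flip: power_mult_distrib)
    finally show ?thesis
      by (simp add: K_def algebra_simps)
  qed
  have "AE x in M. summable (\<lambda>n. \<bar>f (Suc n) x - f n x\<bar>)"
  proof (rule AE_summable_abs)
    show "integrable M (\<lambda>x. f (Suc n) x - f n x)" for n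
      using d by (rule L2_space_integrable)
    show "summable (\<lambda>n. \<integral>x. \<bar>f (Suc n) x - f n x\<bar> \<partial>M)"
    proof (rule summable_comparison_test')
      show "summable (\<lambda>n. K * (1/2)^n)"
        by (intro summable_mult summable_geometric) auto
      show "norm (\<integral>x. \<bar>f (Suc n) x - f n x\<bar> \<partial>M) \<le> K * (1/2)^n" for n
        using incr[of n] by simp
    qed
  qed
  then have conv: "AE x in M. convergent (\<lambda>n. f n x)"
  proof eventually_elim
    case (elim x)
    then have "summable (\<lambda>n. f (Suc n) x - f n x)"
      by (rule summable_rabs_cancel)
    then have "convergent (\<lambda>n. (\<Sum>i<n. f (Suc i) x - f i x) + f 0 x)"
      by (simp add: summable_iff_convergent convergent_add_const_right_iff)
    then show ?case
      by (simp add: sum_lessThan_telescope[of "\<lambda>n. f n x"])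
  qed
  \<comment> \<open>On the null set of divergence \<open>lim\<close> is merely some value; the
    resulting total function is still measurable.\<close>
  define g where "g x = lim (\<lambda>n. f n x)" for x
  have [measurable]: "g \<in> borel_measurable M"
    unfolding g_def by measurable
  have lim: "AE x in M. (\<lambda>n. f n x) \<longlonglongrightarrow> g x"
    using conv by eventually_elim (simp add: g_def convergent_LIMSEQ_iff)
  have bound: "(\<integral>\<^sup>+x. ennreal ((f n x - g x)\<^sup>2) \<partial>M) \<le> ennreal (c * (1/4)^n)" for n
  proof -
    have "(\<integral>\<^sup>+x. ennreal ((f n x - g x)\<^sup>2) \<partial>M) =
        (\<integral>\<^sup>+x. liminf (\<lambda>m. ennreal ((f n x - f m x)\<^sup>2)) \<partial>M)"
    proof (rule nn_integral_cong_AE)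
      show "AE x in M. ennreal ((f n x - g x)\<^sup>2) = liminf (\<lambda>m. ennreal ((f n x - f m x)\<^sup>2))"
        using lim
      proof eventually_elim
        case (elim x)
        then have "(\<lambda>m. ennreal ((f n x - f m x)\<^sup>2)) \<longlonglongrightarrow> ennreal ((f n x - g x)\<^sup>2)"
          by (intro tendsto_ennrealI tendsto_intros)
        then show ?case
          by (rule lim_imp_Liminf[OF trivial_limit_sequentially, symmetric])
      qed
    qed
    also have "\<dots> \<le> liminf (\<lambda>m. \<integral>\<^sup>+x. ennreal ((f n x - f m x)\<^sup>2) \<partial>M)"
      by (rule nn_integral_liminf) measurable
    also have "\<dots> \<le> liminf (\<lambda>m. ennreal (c * (1/4)^n))"
    proof (rule Liminf_mono, rule eventually_sequentiallyI)
      fix m assume "n \<le> m"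
      then show "(\<integral>\<^sup>+x. ennreal ((f n x - f m x)\<^sup>2) \<partial>M) \<le> ennreal (c * (1/4)^n)"
        using Cauchy[of n m] L2_space_integrable_square[OF d]
        by (auto simp: nn_integral_eq_integral intro!: ennreal_leI)
    qed
    also have "\<dots> = ennreal (c * (1/4)^n)"
      by (simp add: Liminf_const)
    finally show ?thesis .
  qed
  have diff: "(\<lambda>x. f n x - g x) \<in> L2_space M" for n
  proof (rule L2_spaceI)
    show "integrable M (\<lambda>x. (f n x - g x)\<^sup>2)"
      using bound[of n] by (intro integrableI_bounded) (auto simp: le_less_trans)
  qed measurable
  \<comment> \<open>Negative reals collapse to 0 in \<open>ennreal\<close>, so the sign of c is
    wanted to read the bound back in the reals.\<close>
  have "c \<ge> 0"
    using Cauchy[of 0 0] by simp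
  have "(\<lambda>n. \<integral>x. (f n x - g x)\<^sup>2 \<partial>M) \<longlonglongrightarrow> 0"
  proof (rule Lim_null_comparison)
    show "(\<lambda>n. c * (1/4)^n) \<longlonglongrightarrow> 0"
      by (intro tendsto_mult_right_zero LIMSEQ_power_zero) simp
    show "\<forall>\<^sub>F n in sequentially. norm (\<integral>x. (f n x - g x)\<^sup>2 \<partial>M) \<le> c * (1/4)^n"
      using bound L2_space_integrable_square[OF diff] \<open>c \<ge> 0\<close>
      by (intro always_eventually allI) (simp add: nn_integral_eq_integral)
  qed
  \<comment> \<open>g is the difference of f 0 and f 0 - g.\<close>
  moreover have "g \<in> L2_space M"
    using L2_space_diff[OF f diff, of 0 0] by simp
  ultimately show thesis
    by (rule that[rotated])
qed

text \<open>At t = -s b the expression equals s b^2 (s a - 2). Choosing s = 1/(a + 1) instead of the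
  minimiser 1/a also covers a = 0. This is the first-order condition for the minimisation that
  follows.\<close>

lemma linear_term_eq_0:
  fixes a b :: real
  assumes nonneg: "\<And>t. 0 \<le> 2 * t * b + t\<^sup>2 * a" and "0 \<le> a"
  shows "b = 0"
proof (rule ccontr)
  assume "b \<noteq> 0"
  define s where "s = 1 / (a + 1)"
  have "0 < s" "s * a \<le> 1"
    using \<open>0 \<le> a\<close> by (auto simp: s_def)
  then have "(s * b\<^sup>2) * (s * a - 2) < 0"
    using \<open>b \<noteq> 0\<close> by (intro mult_pos_neg) auto
  moreover have "0 \<le> (s * b\<^sup>2) * (s * a - 2)"
    using nonneg[of "- (s * b)"] by (simp add: power2_eq_square algebra_simps)
  ultimately show False by simp
qed

text \<open>
  Minimising \<open>\<parallel>F\<parallel>\<^sup>2 - 2 \<phi> F\<close> over the subspace itself gives a representing vector in its closure;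
  neither a continuous extension of \<open>\<phi>\<close> nor an orthogonal projection is needed.
\<close>
lemma (in finite_measure) L2_Riesz_representation:
  fixes \<phi> :: "('a \<Rightarrow> real) \<Rightarrow> real"
  assumes S: "S \<subseteq> L2_space M" "S \<noteq> {}"
    and lincomb: "\<And>a b f g. f \<in> S \<Longrightarrow> g \<in> S \<Longrightarrow> (\<lambda>x. a * f x + b * g x) \<in> S"
    and linear: "\<And>a b f g. f \<in> S \<Longrightarrow> g \<in> S \<Longrightarrow> \<phi> (\<lambda>x. a * f x + b * g x) = a * \<phi> f + b * \<phi> g"
    and bounded: "\<And>f. f \<in> S \<Longrightarrow> \<bar>\<phi> f\<bar> \<le> C * L2_norm M f"
  obtains v where "v \<in> L2_space M" "\<And>f. f \<in> S \<Longrightarrow> (\<integral>x. f x * v x \<partial>M) = \<phi> f"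
proof -
  define J where "J f = (\<integral>x. (f x)\<^sup>2 \<partial>M) - 2 * \<phi> f" for f
  have L2: "f \<in> L2_space M" if "f \<in> S" for f
    using that S by auto
  \<comment> \<open>The bound on \<phi> gives J f at least |f|^2 - 2 C |f| in terms of the norm;
    completing the square makes the infimum finite.\<close>
  have J_ge: "- C\<^sup>2 \<le> J f" if "f \<in> S" for f
  proof -
    have "0 \<le> (L2_norm M f - C)\<^sup>2"
      by simp
    also have "\<dots> = (\<integral>x. (f x)\<^sup>2 \<partial>M) - 2 * (C * L2_norm M f) + C\<^sup>2"
      by (simp add: power2_diff L2_norm_square)
    finally show ?thesis
      using bounded[OF that] by (auto simp: J_def)
  qed
  then have bdd: "bdd_below (J ` S)"
    by (auto intro!: bdd_belowI)
  define m where "m = Inf (J ` S)"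
  have m_le: "m \<le> J f" if "f \<in> S" for f
    unfolding m_def using bdd that by (intro cInf_lower) auto
  \<comment> \<open>The slack 4^-n is chosen to meet the rate demanded by
    \<open>L2_rapid_Cauchy_limit\<close>.\<close>
  have "\<exists>f\<in>S. J f < m + (1/4)^n" for n
    using cInf_lessD[of "J ` S" "m + (1/4)^n"] S(2) by (auto simp: m_def)
  then obtain f where f: "\<And>n. f n \<in> S" and J_f: "\<And>n. J (f n) < m + (1/4)^n"
    by metis
  \<comment> \<open>The midpoint of g and h competes for the infimum, so two near-minimisers must be
    close to each other.\<close>
  have parallelogram: "(\<integral>x. (g x - h x)\<^sup>2 \<partial>M) \<le> 2 * (J g - m) + 2 * (J h - m)"
    if "g \<in> S" "h \<in> S" for g h
  proof -
    let ?k = "\<lambda>x. 1/2 * g x + 1/2 * h x"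
    have "?k \<in> S"
      using that by (rule lincomb)
    then have "4 * m \<le> 4 * J ?k"
      using m_le by simp
    also have "\<dots> = (\<integral>x. (g x)\<^sup>2 \<partial>M) + 2 * (\<integral>x. g x * h x \<partial>M) + (\<integral>x. (h x)\<^sup>2 \<partial>M) - 4 * \<phi> g - 4 * \<phi> h"
      unfolding J_def integral_square_lincomb[OF that[THEN L2]] linear[OF that]
      by (simp add: power2_eq_square algebra_simps)
    finally show ?thesis
      unfolding integral_square_diff[OF that[THEN L2]] by (simp add: J_def)
  qed
  obtain v where v: "v \<in> L2_space M" and f_v: "(\<lambda>n. \<integral>x. (f n x - v x)\<^sup>2 \<partial>M) \<longlonglongrightarrow> 0"
  proof (rule L2_rapid_Cauchy_limit)
    show "f n \<in> L2_space M" for n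
      using f by (rule L2)
    \<comment> \<open>The squared distance is at most 2/4^n + 2/4^k, hence the constant 4.\<close>
    fix n k :: nat assume "n \<le> k"
    then have "(1/4)^k \<le> (1/4 :: real)^n"
      by (intro power_decreasing) auto
    moreover have "x \<le> 4 * p" if "x \<le> 2 * (a - m) + 2 * (b - m)" "a < m + p" "b < m + q" "q \<le> p"
      for x a b p q :: real
      using that by argo
    ultimately show "(\<integral>x. (f n x - f k x)\<^sup>2 \<partial>M) \<le> 4 * (1/4)^n"
      using parallelogram[OF f f, of n k] J_f[of n] J_f[of k] by blast
  qed
  have "(\<integral>x. g x * v x \<partial>M) = \<phi> g" if g: "g \<in> S" for g
  proof -
    let ?A = "\<integral>x. (g x)\<^sup>2 \<partial>M" and ?B = "(\<integral>x. g x * v x \<partial>M) - \<phi> g"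
    \<comment> \<open>The limit v may lie outside S, where nothing is known about \<phi>. So f n is
      perturbed in the direction g, at a loss of at most 4^-n against the infimum, and n then tends
      to infinity.\<close>
    have variation: "0 \<le> 2 * t * ?B + t\<^sup>2 * ?A" for t
    proof (rule LIMSEQ_le_const)
      have "(\<lambda>n. \<integral>x. f n x * g x \<partial>M) \<longlonglongrightarrow> (\<integral>x. v x * g x \<partial>M)"
        using L2[OF f] v L2[OF g] f_v by (rule L2_inner_tendsto)
      then have "(\<lambda>n. (1/4)^n + 2 * t * ((\<integral>x. f n x * g x \<partial>M) - \<phi> g) + t\<^sup>2 * ?A)
          \<longlonglongrightarrow> 0 + 2 * t * ((\<integral>x. v x * g x \<partial>M) - \<phi> g) + t\<^sup>2 * ?A"
        by (intro tendsto_intros LIMSEQ_power_zero) auto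
      then show "(\<lambda>n. (1/4)^n + 2 * t * ((\<integral>x. f n x * g x \<partial>M) - \<phi> g) + t\<^sup>2 * ?A)
          \<longlonglongrightarrow> 2 * t * ?B + t\<^sup>2 * ?A"
        by (simp add: mult.commute)
      have "0 \<le> (1/4)^n + 2 * t * ((\<integral>x. f n x * g x \<partial>M) - \<phi> g) + t\<^sup>2 * ?A" for n
      proof -
        have "m \<le> J (\<lambda>x. 1 * f n x + t * g x)"
          using f g by (intro m_le lincomb)
        also have "\<dots> = J (f n) + 2 * t * ((\<integral>x. f n x * g x \<partial>M) - \<phi> g) + t\<^sup>2 * ?A"
          unfolding J_def integral_square_lincomb[OF L2[OF f] L2[OF g]] linear[OF f g]
          by (simp add: algebra_simps)
        finally show ?thesis
          using J_f[of n] by simp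
      qed
      then show "\<exists>N. \<forall>n\<ge>N. 0 \<le> (1/4)^n + 2 * t * ((\<integral>x. f n x * g x \<partial>M) - \<phi> g) + t\<^sup>2 * ?A"
        by blast
    qed
    have "?B = 0"
      using variation by (rule linear_term_eq_0) simp
    then show ?thesis by simp
  qed
  with v show thesis
    by (rule that)
qed

section \<open>Conditional expectation on L2, and L2 over a product with counting measure\<close>

lemma (in finite_measure_subalgebra) cond_exp_L2:
  assumes "f \<in> L2_space M"
  shows "real_cond_exp M F f \<in> L2_space M"
proof (rule L2_spaceI)
  show "integrable M (\<lambda>x. (real_cond_exp M F f x)\<^sup>2)"
    using assms L2_space_integrable[OF assms] L2_space_integrable_square[OF assms]
    by (intro integrable_convex_cond_exp[where I=UNIV and X=f and q="\<lambda>x. x\<^sup>2"])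
      (auto intro!: convex_power2)
qed simp

text \<open>The factor E[g | F] is F-measurable and can be pulled out of the conditional expectation
  of f. It brings mixed terms into a form symmetric in f and g.\<close>

lemma (in finite_measure_subalgebra) integral_cond_exp_mult:
  assumes "f \<in> L2_space M" "g \<in> L2_space M"
  shows "(\<integral>x. f x * real_cond_exp M F g x \<partial>M) = (\<integral>x. real_cond_exp M F f x * real_cond_exp M F g x \<partial>M)"
proof -
  have "(\<integral>x. real_cond_exp M F g x * real_cond_exp M F f x \<partial>M) = (\<integral>x. real_cond_exp M F g x * f x \<partial>M)"
    using assms by (intro real_cond_exp_intg L2_space_integrable_mult cond_exp_L2) (auto dest: L2_space_measurable)
  then show ?thesis
    by (simp add: mult.commute)
qed

lemma (in sigma_finite_measure) nn_integral_count_space_pair: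
  assumes "f \<in> borel_measurable (count_space (UNIV :: nat set) \<Otimes>\<^sub>M M)"
  shows "(\<integral>\<^sup>+z. f z \<partial>(count_space UNIV \<Otimes>\<^sub>M M)) = (\<Sum>k. \<integral>\<^sup>+x. f (k, x) \<partial>M)"
  using nn_integral_fst[OF assms] by (simp add: nn_integral_count_space_nat)

text \<open>Tonelli in both directions. Joint measurability follows from that of the sections
  because the index set is countable and discrete.\<close>

lemma (in sigma_finite_measure) L2_space_count_space_pair:
  fixes U :: "nat \<times> 'a \<Rightarrow> real"
  shows "U \<in> L2_space (count_space UNIV \<Otimes>\<^sub>M M) \<longleftrightarrow>
      (\<forall>k. (\<lambda>x. U (k, x)) \<in> L2_space M) \<and> summable (\<lambda>k. \<integral>x. (U (k, x))\<^sup>2 \<partial>M)"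
    (is "_ \<longleftrightarrow> ?R")
    and integral_square_count_space_pair: "U \<in> L2_space (count_space UNIV \<Otimes>\<^sub>M M) \<Longrightarrow>
      (\<integral>z. (U z)\<^sup>2 \<partial>(count_space UNIV \<Otimes>\<^sub>M M)) = (\<Sum>k. \<integral>x. (U (k, x))\<^sup>2 \<partial>M)"
proof -
  let ?K = "count_space UNIV \<Otimes>\<^sub>M M"
  have nn: "(\<integral>\<^sup>+z. ennreal ((U z)\<^sup>2) \<partial>?K) = (\<Sum>k. \<integral>\<^sup>+x. ennreal ((U (k, x))\<^sup>2) \<partial>M)"
    if "U \<in> borel_measurable ?K"
    using that by (subst nn_integral_count_space_pair) auto
  have R: ?R if U: "U \<in> L2_space ?K"
  proof
    have [measurable]: "U \<in> borel_measurable ?K"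
      using U by (rule L2_space_measurable)
    have fin: "(\<integral>\<^sup>+z. ennreal ((U z)\<^sup>2) \<partial>?K) < \<infinity>"
      using L2_space_integrable_square[OF U] by (simp add: nn_integral_eq_integral)
    show sec: "\<forall>k. (\<lambda>x. U (k, x)) \<in> L2_space M"
    proof (intro allI L2_spaceI)
      fix k
      show m: "(\<lambda>x. U (k, x)) \<in> borel_measurable M"
        by measurable
      have "(\<integral>\<^sup>+x. ennreal ((U (k, x))\<^sup>2) \<partial>M) \<le> (\<Sum>k. \<integral>\<^sup>+x. ennreal ((U (k, x))\<^sup>2) \<partial>M)"
        using sum_le_suminf[of "\<lambda>k. \<integral>\<^sup>+x. ennreal ((U (k, x))\<^sup>2) \<partial>M" "{k}"] by simp
      with fin show "integrable M (\<lambda>x. (U (k, x))\<^sup>2)"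
        using m by (intro integrableI_bounded) (auto simp: nn)
    qed
    show "summable (\<lambda>k. \<integral>x. (U (k, x))\<^sup>2 \<partial>M)"
    proof (rule summable_suminf_not_top)
      show "(\<Sum>k. ennreal (\<integral>x. (U (k, x))\<^sup>2 \<partial>M)) \<noteq> top"
        using fin sec by (simp add: nn nn_integral_eq_integral L2_space_integrable_square)
    qed simp
  qed
  have nn': "(\<integral>\<^sup>+z. ennreal ((U z)\<^sup>2) \<partial>?K) = ennreal (\<Sum>k. \<integral>x. (U (k, x))\<^sup>2 \<partial>M)"
    if "U \<in> borel_measurable ?K" ?R
    using that by (simp add: nn nn_integral_eq_integral L2_space_integrable_square suminf_ennreal2)
  show "U \<in> L2_space ?K \<longleftrightarrow> ?R"
  proof
    assume r: ?R
    then have m: "U \<in> borel_measurable ?K"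
      by (intro measurable_pair_measure_countable1) (auto dest: L2_space_measurable)
    with nn'[OF m r] show "U \<in> L2_space ?K"
      by (intro L2_spaceI integrableI_bounded) auto
  qed (rule R)
  show "(\<integral>z. (U z)\<^sup>2 \<partial>?K) = (\<Sum>k. \<integral>x. (U (k, x))\<^sup>2 \<partial>M)" if U: "U \<in> L2_space ?K"
  proof -
    have "0 \<le> (\<Sum>k. \<integral>x. (U (k, x))\<^sup>2 \<partial>M)"
      using R[OF U] by (intro suminf_nonneg) auto
    then show ?thesis
      using nn'[OF L2_space_measurable[OF U] R[OF U]] L2_space_integrable_square[OF U]
      by (simp add: nn_integral_eq_integral)
  qed
qed

section \<open>Transport along maps with a prescribed law, and factorisation through a map\<close>

lemma L2_space_distr:
  assumes "T \<in> N \<rightarrow>\<^sub>M N'" "distr N N' T = N'" "f \<in> L2_space N'"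
  shows "(\<lambda>x. f (T x)) \<in> L2_space N"
proof (rule L2_spaceI)
  have f: "f \<in> borel_measurable N'" "integrable (distr N N' T) (\<lambda>x. (f x)\<^sup>2)"
    using assms by (simp_all add: L2_space_def)
  show "(\<lambda>x. f (T x)) \<in> borel_measurable N"
    using assms(1) f(1) by measurable
  show "integrable N (\<lambda>x. (f (T x))\<^sup>2)"
    using assms(1) f(2) by (rule integrable_distr)
qed

lemma integral_distr_same:
  fixes f :: "'b \<Rightarrow> real"
  assumes "T \<in> N \<rightarrow>\<^sub>M N'" "distr N N' T = N'" "f \<in> borel_measurable N'"
  shows "(\<integral>x. f (T x) \<partial>N) = (\<integral>y. f y \<partial>N')"
  using integral_distr[OF assms(1,3)] assms(2) by simp

text \<open>Doob--Dynkin: the factor is rebuilt from the preimages of its rational sublevel sets.\<close>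
lemma borel_measurable_vimage_algebra_factor:
  fixes F :: "'a \<Rightarrow> real"
  assumes F: "F \<in> borel_measurable (vimage_algebra \<Omega> T N)" and T: "T \<in> \<Omega> \<rightarrow> space N"
  obtains f where "f \<in> borel_measurable N" "\<And>\<omega>. \<omega> \<in> \<Omega> \<Longrightarrow> F \<omega> = f (T \<omega>)"
proof -
  have "\<exists>B\<in>sets N. {\<omega>\<in>\<Omega>. F \<omega> < of_rat q} = T -` B \<inter> \<Omega>" for q
  proof -
    have "{\<omega> \<in> space (vimage_algebra \<Omega> T N). F \<omega> < of_rat q} \<in> sets (vimage_algebra \<Omega> T N)"
      using F by measurable
    then show ?thesis
      using T by (auto simp: sets_vimage_algebra2)
  qed
  then obtain B where B [measurable]: "\<And>q. B q \<in> sets N"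
    and F_B: "\<And>q. {\<omega>\<in>\<Omega>. F \<omega> < of_rat q} = T -` B q \<inter> \<Omega>"
    by metis
  \<comment> \<open>On the range of T this recovers the value of F as the infimum of the rationals
    above it. Elsewhere the infimum may be infinite in either direction, so it is formed in
    \<open>ereal\<close> and converted at the end.\<close>
  define g where "g x = (INF q. if x \<in> B q then ereal (of_rat q) else \<infinity>)" for x
  have [measurable]: "g \<in> borel_measurable N"
    unfolding g_def by measurable
  have "g (T \<omega>) = ereal (F \<omega>)" if \<omega>: "\<omega> \<in> \<Omega>" for \<omega>
  proof (rule antisym)
    have mem: "T \<omega> \<in> B q \<longleftrightarrow> F \<omega> < of_rat q" for q
      using F_B[of q] \<omega> by auto
    show "ereal (F \<omega>) \<le> g (T \<omega>)"
      unfolding g_def by (rule INF_greatest) (auto simp: mem)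
    show "g (T \<omega>) \<le> ereal (F \<omega>)"
    proof (rule ereal_le_epsilon2)
      fix e :: real assume "0 < e"
      then obtain q where q: "F \<omega> < of_rat q" "of_rat q < F \<omega> + e"
        using of_rat_dense[of "F \<omega>" "F \<omega> + e"] by auto
      have "g (T \<omega>) \<le> (if T \<omega> \<in> B q then ereal (of_rat q) else \<infinity>)"
        unfolding g_def by (rule INF_lower) simp
      also have "\<dots> \<le> ereal (F \<omega>) + ereal e"
        using q by (simp add: mem)
      finally show "g (T \<omega>) \<le> ereal (F \<omega>) + ereal e" .
    qed
  qed
  then show thesis
    by (intro that[of "\<lambda>x. real_of_ereal (g x)"]) auto
qed

text \<open>Conditional Jensen for the absolute value, then integration. It removes the conditioning
  when the series in \<open>Gamma0\<close> is dominated.\<close>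

lemma (in sigma_finite_subalgebra) integral_abs_cond_exp_le:
  assumes f: "integrable M f"
  shows "(\<integral>x. \<bar>real_cond_exp M F f x\<bar> \<partial>M) \<le> (\<integral>x. \<bar>f x\<bar> \<partial>M)"
proof -
  have [measurable]: "f \<in> borel_measurable M"
    using f by simp
  have "(\<integral>\<^sup>+x. ennreal \<bar>real_cond_exp M F f x\<bar> \<partial>M) \<le> (\<integral>\<^sup>+x. nn_cond_exp M F (\<lambda>x. ennreal \<bar>f x\<bar>) x \<partial>M)"
    by (rule nn_integral_mono_AE) (rule real_cond_exp_abs, measurable)
  also have "\<dots> = (\<integral>\<^sup>+x. ennreal \<bar>f x\<bar> \<partial>M)"
    using nn_cond_exp_intg[of "\<lambda>_. 1" "\<lambda>x. ennreal \<bar>f x\<bar>"] by simp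
  finally show ?thesis
    using f real_cond_exp_int(1)[OF f] by (simp add: nn_integral_eq_integral integral_nonneg)
qed

section \<open>The closure of the difference operators and the divergence\<close>

text \<open>D, its closure, \<delta> and L are built from the single sequence X; the independent
  copy joins only in the extension of this locale.\<close>

locale coord_sequence = prob_space P
  for P :: "'w measure" and M :: "nat \<Rightarrow> 'a measure" and X :: "'w \<Rightarrow> nat \<Rightarrow> 'a" +
  assumes prob_space_M: "\<And>n. prob_space (M n)"
    and X_measurable [measurable]: "X \<in> P \<rightarrow>\<^sub>M PiM UNIV M"
    and distr_X: "distr P (PiM UNIV M) X = PiM UNIV M"
begin

lemma coord_measurable [measurable]: "(\<lambda>\<omega>. X \<omega> j) \<in> P \<rightarrow>\<^sub>M M j"
  by measurable

lemma space_sigma_coords [simp]: "space (sigma_coords M P X J) = space P"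
  by (simp add: sigma_coords_def space_measure_of_conv)

lemma sets_sigma_coords:
  "sets (sigma_coords M P X J) =
    sigma_sets (space P) (\<Union>j\<in>J. {(\<lambda>\<omega>. X \<omega> j) -` A \<inter> space P | A. A \<in> sets (M j)})"
  unfolding sigma_coords_def by (rule sets_measure_of) auto

lemma measurable_sigma_coords:
  assumes "j \<in> J"
  shows "(\<lambda>\<omega>. X \<omega> j) \<in> sigma_coords M P X J \<rightarrow>\<^sub>M M j"
proof (rule measurableI)
  fix A assume "A \<in> sets (M j)"
  then show "(\<lambda>\<omega>. X \<omega> j) -` A \<inter> space (sigma_coords M P X J) \<in> sets (sigma_coords M P X J)"
    using assms by (auto simp: sets_sigma_coords)
qed (auto dest: measurable_space[OF coord_measurable])

text \<open>Minimality of the generated sigma-algebra, in a form that serves for all inclusions: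
  into \<open>P\<close>, into \<open>sigma_X\<close>, into larger coordinate sets, and into the
  sigma-algebra of a sequence with one frozen coordinate.\<close>

lemma sets_sigma_coords_subset:
  assumes "space N = space P" "\<And>j. j \<in> J \<Longrightarrow> (\<lambda>\<omega>. X \<omega> j) \<in> N \<rightarrow>\<^sub>M M j"
  shows "sets (sigma_coords M P X J) \<subseteq> sets N"
  unfolding sets_sigma_coords assms(1)[symmetric]
  using assms(2) by (intro sets.sigma_sets_subset) (auto intro: measurable_sets)

lemma sets_sigma_coords_mono: "J \<subseteq> K \<Longrightarrow> sets (sigma_coords M P X J) \<subseteq> sets (sigma_coords M P X K)"
  by (intro sets_sigma_coords_subset measurable_sigma_coords) auto

lemma borel_measurable_sigma_coords_mono:
  assumes "J \<subseteq> K" "f \<in> borel_measurable (sigma_coords M P X J)"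
  shows "f \<in> borel_measurable (sigma_coords M P X K)"
  using assms(2) sets_sigma_coords_mono[OF assms(1)] by (auto simp: measurable_def)

lemma subalgebra_sigma_X: "subalgebra P (sigma_X M P X)"
  unfolding subalgebra_def sigma_X_def using sets_image_in_sets[OF refl X_measurable] by simp

lemma subalgebra_sigma_coords: "subalgebra P (sigma_coords M P X J)"
  unfolding subalgebra_def using sets_sigma_coords_subset[OF refl coord_measurable] by simp

lemma subalgebra_sigma_X_sigma_coords: "subalgebra (sigma_X M P X) (sigma_coords M P X J)"
proof -
  have "(\<lambda>\<omega>. X \<omega> j) \<in> sigma_X M P X \<rightarrow>\<^sub>M M j" for j
  proof -
    have "X \<in> sigma_X M P X \<rightarrow>\<^sub>M PiM UNIV M"
      unfolding sigma_X_def
      using measurable_space[OF X_measurable] by (intro measurable_vimage_algebra1) blast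
    then show ?thesis by measurable
  qed
  then show ?thesis
    unfolding subalgebra_def
    using sets_sigma_coords_subset[of "sigma_X M P X" J] by (simp add: sigma_X_def)
qed

lemma finite_measure_subalgebra_sigma_X: "finite_measure_subalgebra P (sigma_X M P X)"
  by unfold_locales (rule subalgebra_sigma_X)

lemma finite_measure_subalgebra_sigma_coords: "finite_measure_subalgebra P (sigma_coords M P X J)"
  by unfold_locales (rule subalgebra_sigma_coords)

lemma prob_space_P_X: "prob_space (P_X M P X)"
  unfolding P_X_def by (rule prob_space_restr_to_subalg[OF subalgebra_sigma_X]) unfold_locales

lemma borel_measurable_P_X: "borel_measurable (P_X M P X) = borel_measurable (sigma_X M P X)"
  unfolding P_X_def by (rule measurable_cong_sets) (simp_all add: sets_restr_to_subalg[OF subalgebra_sigma_X])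

lemma integral_P_X:
  fixes f :: "'w \<Rightarrow> real"
  assumes "f \<in> borel_measurable (P_X M P X)"
  shows "(\<integral>\<omega>. f \<omega> \<partial>P_X M P X) = (\<integral>\<omega>. f \<omega> \<partial>P)"
  using assms integral_subalgebra2[OF subalgebra_sigma_X] unfolding P_X_def[symmetric] borel_measurable_P_X
  by blast

text \<open>This lets L2 estimates be made under \<open>P\<close>, where the conditional
  expectations live, while sigma(X)-measurability is tracked separately.\<close>

lemma L2_space_P_X_iff:
  "f \<in> L2_space (P_X M P X) \<longleftrightarrow> f \<in> borel_measurable (P_X M P X) \<and> f \<in> L2_space P"
proof
  assume f: "f \<in> L2_space (P_X M P X)"
  then have "f \<in> borel_measurable (sigma_X M P X)" "integrable (restr_to_subalg P (sigma_X M P X)) (\<lambda>x. (f x)\<^sup>2)"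
    by (auto dest: L2_space_measurable L2_space_integrable_square simp: borel_measurable_P_X simp flip: P_X_def)
  with f show "f \<in> borel_measurable (P_X M P X) \<and> f \<in> L2_space P"
    using subalgebra_sigma_X
    by (auto intro!: L2_spaceI intro: measurable_from_subalg integrable_from_subalg simp: borel_measurable_P_X)
next
  assume f: "f \<in> borel_measurable (P_X M P X) \<and> f \<in> L2_space P"
  then have "integrable (P_X M P X) (\<lambda>x. (f x)\<^sup>2)"
    unfolding P_X_def
    by (intro integrable_in_subalg subalgebra_sigma_X)
      (auto simp: borel_measurable_P_X simp flip: P_X_def dest: L2_space_integrable_square)
  with f show "f \<in> L2_space (P_X M P X)"
    by (auto intro: L2_spaceI)
qed

lemma L2_norm_P_X: "f \<in> L2_space (P_X M P X) \<Longrightarrow> L2_norm (P_X M P X) f = L2_norm P f"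
  unfolding L2_norm_def by (subst integral_P_X) (auto dest: L2_space_measurable)

lemma borel_measurable_P_X_sigma_coords:
  "f \<in> borel_measurable (sigma_coords M P X J) \<Longrightarrow> f \<in> borel_measurable (P_X M P X)"
  unfolding borel_measurable_P_X by (rule measurable_from_subalg[OF subalgebra_sigma_X_sigma_coords])

section \<open>The operators \<open>D_coord\<close> on L2\<close>

lemma D_coord_measurable:
  assumes "f \<in> borel_measurable (P_X M P X)"
  shows "D_coord M P X k f \<in> borel_measurable (P_X M P X)"
proof -
  have "real_cond_exp P (sigma_coords M P X (- {k})) f \<in> borel_measurable (P_X M P X)"
    by (rule borel_measurable_P_X_sigma_coords[OF borel_measurable_cond_exp])
  then show ?thesis
    using assms unfolding D_coord_def by measurable
qed

lemma D_coord_L2: "f \<in> L2_space P \<Longrightarrow> D_coord M P X k f \<in> L2_space P"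
  unfolding D_coord_def
  by (intro L2_space_diff finite_measure_subalgebra.cond_exp_L2 finite_measure_subalgebra_sigma_coords)

lemma D_coord_L2_P_X: "f \<in> L2_space (P_X M P X) \<Longrightarrow> D_coord M P X k f \<in> L2_space (P_X M P X)"
  by (simp add: L2_space_P_X_iff D_coord_L2 D_coord_measurable)

text \<open>Polarised Pythagoras: \<open>E\<close> is an orthogonal projection and D_k the
  complementary one. Resampling produces the same right-hand side, which is where the two sides of
  the theorem meet.\<close>

lemma integral_D_coord_mult:
  fixes k :: nat
  assumes f: "f \<in> L2_space P" and g: "g \<in> L2_space P"
  defines "E \<equiv> real_cond_exp P (sigma_coords M P X (- {k}))"
  shows "(\<integral>\<omega>. D_coord M P X k f \<omega> * D_coord M P X k g \<omega> \<partial>P) = (\<integral>\<omega>. f \<omega> * g \<omega> \<partial>P) - (\<integral>\<omega>. E f \<omega> * E g \<omega> \<partial>P)"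
proof -
  interpret E: finite_measure_subalgebra P "sigma_coords M P X (- {k})"
    by (rule finite_measure_subalgebra_sigma_coords)
  note [simp] = L2_space_integrable_mult E.cond_exp_L2[folded E_def] f g
  have "(\<integral>\<omega>. D_coord M P X k f \<omega> * D_coord M P X k g \<omega> \<partial>P) =
      (\<integral>\<omega>. f \<omega> * g \<omega> - f \<omega> * E g \<omega> - g \<omega> * E f \<omega> + E f \<omega> * E g \<omega> \<partial>P)"
    by (intro Bochner_Integration.integral_cong) (auto simp: D_coord_def E_def algebra_simps)
  also have "\<dots> = (\<integral>\<omega>. f \<omega> * g \<omega> \<partial>P) - (\<integral>\<omega>. f \<omega> * E g \<omega> \<partial>P) - (\<integral>\<omega>. g \<omega> * E f \<omega> \<partial>P) + (\<integral>\<omega>. E f \<omega> * E g \<omega> \<partial>P)"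
    by simp
  also have "(\<integral>\<omega>. f \<omega> * E g \<omega> \<partial>P) = (\<integral>\<omega>. E f \<omega> * E g \<omega> \<partial>P)"
    unfolding E_def using f g by (rule E.integral_cond_exp_mult)
  also have "(\<integral>\<omega>. g \<omega> * E f \<omega> \<partial>P) = (\<integral>\<omega>. E g \<omega> * E f \<omega> \<partial>P)"
    unfolding E_def using g f by (rule E.integral_cond_exp_mult)
  finally show ?thesis
    by (simp add: mult.commute)
qed

lemma integral_D_coord_square_le:
  assumes "f \<in> L2_space P"
  shows "(\<integral>\<omega>. (D_coord M P X k f \<omega>)\<^sup>2 \<partial>P) \<le> (\<integral>\<omega>. (f \<omega>)\<^sup>2 \<partial>P)"
  using integral_D_coord_mult[OF assms assms, of k] by (simp flip: power2_eq_square)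

text \<open>\<open>real_cond_exp\<close> is one fixed version, so linearity is obtained off a null
  set that may depend on k, on the functions and on the coefficients.\<close>

lemma D_coord_lincomb:
  assumes "f \<in> L2_space P" "g \<in> L2_space P"
  shows "AE \<omega> in P. D_coord M P X k (\<lambda>\<omega>. a * f \<omega> + b * g \<omega>) \<omega> = a * D_coord M P X k f \<omega> + b * D_coord M P X k g \<omega>"
proof -
  interpret E: finite_measure_subalgebra P "sigma_coords M P X (- {k})"
    by (rule finite_measure_subalgebra_sigma_coords)
  have int: "integrable P f" "integrable P g"
    using assms by (simp_all add: L2_space_integrable)
  note E.real_cond_exp_add[OF integrable_mult_right[OF int(1), of a] integrable_mult_right[OF int(2), of b]]
    and E.real_cond_exp_cmult[OF int(1), of a] and E.real_cond_exp_cmult[OF int(2), of b]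
  then show ?thesis
    unfolding D_coord_def by eventually_elim (simp add: right_diff_distrib)
qed

lemma D_coord_diff:
  assumes "f \<in> L2_space P" "g \<in> L2_space P"
  shows "AE \<omega> in P. D_coord M P X k (\<lambda>\<omega>. f \<omega> - g \<omega>) \<omega> = D_coord M P X k f \<omega> - D_coord M P X k g \<omega>"
  using D_coord_lincomb[OF assms, of k 1 "-1"] by simp

lemma D_coord_borel_measurable [measurable]:
  assumes [measurable]: "f \<in> borel_measurable P"
  shows "D_coord M P X k f \<in> borel_measurable P"
  unfolding D_coord_def by measurable

abbreviation DD :: "('w \<Rightarrow> real) \<Rightarrow> nat \<times> 'w \<Rightarrow> real" where
  "DD f \<equiv> \<lambda>(k, \<omega>). D_coord M P X k f \<omega>"

lemma L2_space_kappa_P_X: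
  "U \<in> L2_space (kappa_P_X M P X) \<longleftrightarrow>
    (\<forall>k. (\<lambda>\<omega>. U (k, \<omega>)) \<in> L2_space (P_X M P X)) \<and> summable (\<lambda>k. \<integral>\<omega>. (U (k, \<omega>))\<^sup>2 \<partial>P)"
  and L2_norm_kappa_P_X:
  "U \<in> L2_space (kappa_P_X M P X) \<Longrightarrow>
    (L2_norm (kappa_P_X M P X) U)\<^sup>2 = (\<Sum>k. \<integral>\<omega>. (U (k, \<omega>))\<^sup>2 \<partial>P)"
proof -
  interpret N: prob_space "P_X M P X"
    by (rule prob_space_P_X)
  have eq: "(\<integral>\<omega>. (U (k, \<omega>))\<^sup>2 \<partial>P_X M P X) = (\<integral>\<omega>. (U (k, \<omega>))\<^sup>2 \<partial>P)"
    if "(\<lambda>\<omega>. U (k, \<omega>)) \<in> L2_space (P_X M P X)" for k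
    using L2_space_measurable[OF that] by (intro integral_P_X) measurable
  show *: "U \<in> L2_space (kappa_P_X M P X) \<longleftrightarrow>
    (\<forall>k. (\<lambda>\<omega>. U (k, \<omega>)) \<in> L2_space (P_X M P X)) \<and> summable (\<lambda>k. \<integral>\<omega>. (U (k, \<omega>))\<^sup>2 \<partial>P)"
    unfolding kappa_P_X_def N.L2_space_count_space_pair using eq by auto
  assume U: "U \<in> L2_space (kappa_P_X M P X)"
  then show "(L2_norm (kappa_P_X M P X) U)\<^sup>2 = (\<Sum>k. \<integral>\<omega>. (U (k, \<omega>))\<^sup>2 \<partial>P)"
    using * eq N.integral_square_count_space_pair[of U]
    by (simp add: L2_norm_square kappa_P_X_def)
qed

section \<open>The core, the closed graph and its domain\<close>

lemma D_core_P_X: "f \<in> D_core M P X \<Longrightarrow> f \<in> L2_space (P_X M P X)"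
  by (simp add: D_core_def)

lemma D_core_lincomb:
  assumes "f \<in> D_core M P X" "g \<in> D_core M P X"
  shows "(\<lambda>\<omega>. a * f \<omega> + b * g \<omega>) \<in> D_core M P X"
proof -
  obtain i j where "f \<in> borel_measurable (sigma_coords M P X {..i})" "g \<in> borel_measurable (sigma_coords M P X {..j})"
    using assms by (auto simp: D_core_def)
  then have [measurable]: "f \<in> borel_measurable (sigma_coords M P X {..max i j})"
      "g \<in> borel_measurable (sigma_coords M P X {..max i j})"
    by (auto elim!: borel_measurable_sigma_coords_mono[rotated])
  have "(\<lambda>\<omega>. a * f \<omega> + b * g \<omega>) \<in> borel_measurable (sigma_coords M P X {..max i j})"
    by measurable
  moreover have "(\<lambda>\<omega>. a * f \<omega> + b * g \<omega>) \<in> L2_space (P_X M P X)"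
    using assms by (intro L2_space_lincomb D_core_P_X)
  ultimately show ?thesis
    by (auto simp only: D_core_def)
qed

text \<open>A core element depends on the coordinates up to some n, so G_k determines it for k > n
  and only finitely many D_k f differ from 0. Membership in L2 is what gives the norms in
  \<open>D_graph\<close> their meaning: a non-integrable square would have integral 0.\<close>

lemma D_core_DD_L2:
  assumes "f \<in> D_core M P X"
  shows "DD f \<in> L2_space (kappa_P_X M P X)"
proof -
  have f: "f \<in> L2_space (P_X M P X)"
    using assms by (rule D_core_P_X)
  obtain n where n: "f \<in> borel_measurable (sigma_coords M P X {..n})"
    using assms by (auto simp: D_core_def)
  have "(\<integral>\<omega>. (D_coord M P X k f \<omega>)\<^sup>2 \<partial>P) = 0" if "k \<notin> {..n}" for k
  proof -
    interpret E: finite_measure_subalgebra P "sigma_coords M P X (- {k})"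
      by (rule finite_measure_subalgebra_sigma_coords)
    have "f \<in> borel_measurable (sigma_coords M P X (- {k}))"
      using that by (intro borel_measurable_sigma_coords_mono[OF _ n]) auto
    then have "AE \<omega> in P. real_cond_exp P (sigma_coords M P X (- {k})) f \<omega> = f \<omega>"
      using f by (intro E.real_cond_exp_F_meas L2_space_integrable) (auto simp: L2_space_P_X_iff)
    then have "AE \<omega> in P. (D_coord M P X k f \<omega>)\<^sup>2 = 0"
      by eventually_elim (simp add: D_coord_def)
    then show ?thesis
      by (rule integral_eq_zero_AE)
  qed
  then have "summable (\<lambda>k. \<integral>\<omega>. (D_coord M P X k f \<omega>)\<^sup>2 \<partial>P)"
    by (intro summable_finite[of "{..n}"]) auto
  then show ?thesis
    by (simp add: L2_space_kappa_P_X D_coord_L2_P_X[OF f])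
qed

lemma DD_diff_L2:
  assumes "f \<in> D_core M P X" "U \<in> L2_space (kappa_P_X M P X)"
  shows "(\<lambda>(k, \<omega>). D_coord M P X k f \<omega> - U (k, \<omega>)) \<in> L2_space (kappa_P_X M P X)"
  using L2_space_diff[OF D_core_DD_L2[OF assms(1)] assms(2)] by (simp add: case_prod_beta')

text \<open>The closure in terms of integrals over \<open>P\<close> and series over k. Summability
  is part of the conclusion because the value of a divergent series carries no information.\<close>

lemma D_graphD:
  assumes "(F, U) \<in> D_graph M P X"
  obtains S where "F \<in> L2_space (P_X M P X)" "U \<in> L2_space (kappa_P_X M P X)"
    "\<And>m. S m \<in> D_core M P X"
    "(\<lambda>m. \<integral>\<omega>. (S m \<omega> - F \<omega>)\<^sup>2 \<partial>P) \<longlonglongrightarrow> 0"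
    "\<And>m. summable (\<lambda>k. \<integral>\<omega>. (D_coord M P X k (S m) \<omega> - U (k, \<omega>))\<^sup>2 \<partial>P)"
    "(\<lambda>m. \<Sum>k. \<integral>\<omega>. (D_coord M P X k (S m) \<omega> - U (k, \<omega>))\<^sup>2 \<partial>P) \<longlonglongrightarrow> 0"
proof -
  obtain S where F: "F \<in> L2_space (P_X M P X)" and U: "U \<in> L2_space (kappa_P_X M P X)"
    and S: "\<And>m. S m \<in> D_core M P X"
    and SF: "(\<lambda>m. L2_norm (P_X M P X) (\<lambda>\<omega>. S m \<omega> - F \<omega>)) \<longlonglongrightarrow> 0"
    and SU: "(\<lambda>m. L2_norm (kappa_P_X M P X) (\<lambda>(k, \<omega>). D_coord M P X k (S m) \<omega> - U (k, \<omega>))) \<longlonglongrightarrow> 0"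
    using assms unfolding D_graph_def by blast
  show thesis
  proof (rule that[OF F U S])
    have "L2_norm (P_X M P X) (\<lambda>\<omega>. S m \<omega> - F \<omega>) = L2_norm P (\<lambda>\<omega>. S m \<omega> - F \<omega>)" for m
      using F D_core_P_X[OF S] by (intro L2_norm_P_X L2_space_diff)
    then show "(\<lambda>m. \<integral>\<omega>. (S m \<omega> - F \<omega>)\<^sup>2 \<partial>P) \<longlonglongrightarrow> 0"
      using SF by (simp add: L2_norm_tendsto_0_iff)
    show "summable (\<lambda>k. \<integral>\<omega>. (D_coord M P X k (S m) \<omega> - U (k, \<omega>))\<^sup>2 \<partial>P)" for m
      using DD_diff_L2[OF S U] by (simp add: L2_space_kappa_P_X)
    show "(\<lambda>m. \<Sum>k. \<integral>\<omega>. (D_coord M P X k (S m) \<omega> - U (k, \<omega>))\<^sup>2 \<partial>P) \<longlonglongrightarrow> 0"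
      using tendsto_power[OF SU, of 2] by (simp add: L2_norm_kappa_P_X[OF DD_diff_L2[OF S U]])
  qed
qed

lemma D_graphI:
  assumes F: "F \<in> L2_space (P_X M P X)" and U: "U \<in> L2_space (kappa_P_X M P X)"
    and S: "\<And>m. S m \<in> D_core M P X"
    and SF: "(\<lambda>m. \<integral>\<omega>. (S m \<omega> - F \<omega>)\<^sup>2 \<partial>P) \<longlonglongrightarrow> 0"
    and SU: "(\<lambda>m. \<Sum>k. \<integral>\<omega>. (D_coord M P X k (S m) \<omega> - U (k, \<omega>))\<^sup>2 \<partial>P) \<longlonglongrightarrow> 0"
  shows "(F, U) \<in> D_graph M P X"
proof -
  have "L2_norm (P_X M P X) (\<lambda>\<omega>. S m \<omega> - F \<omega>) = L2_norm P (\<lambda>\<omega>. S m \<omega> - F \<omega>)" for m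
    using F D_core_P_X[OF S] by (intro L2_norm_P_X L2_space_diff)
  then have "(\<lambda>m. L2_norm (P_X M P X) (\<lambda>\<omega>. S m \<omega> - F \<omega>)) \<longlonglongrightarrow> 0"
    using SF by (simp add: L2_norm_tendsto_0_iff)
  moreover have "(\<lambda>m. L2_norm (kappa_P_X M P X) (\<lambda>(k, \<omega>). D_coord M P X k (S m) \<omega> - U (k, \<omega>))) \<longlonglongrightarrow> 0"
    unfolding L2_norm_tendsto_0_iff L2_norm_square[symmetric]
    using SU by (simp add: L2_norm_kappa_P_X[OF DD_diff_L2[OF S U]])
  ultimately show ?thesis
    using F U S unfolding D_graph_def by blast
qed

lemma D_graph_L2:
  assumes "(F, U) \<in> D_graph M P X"
  shows "F \<in> L2_space (P_X M P X)" "U \<in> L2_space (kappa_P_X M P X)"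
  using assms by (auto simp: D_graph_def)

lemma dom_D_L2: "F \<in> dom_D M P X \<Longrightarrow> F \<in> L2_space (P_X M P X)"
  by (auto simp: dom_D_def dest: D_graph_L2)

lemma L2_space_kappa_P_XD:
  assumes "U \<in> L2_space (kappa_P_X M P X)"
  shows "(\<lambda>\<omega>. U (k, \<omega>)) \<in> L2_space P" "summable (\<lambda>k. \<integral>\<omega>. (U (k, \<omega>))\<^sup>2 \<partial>P)"
  using assms by (auto simp: L2_space_kappa_P_X L2_space_P_X_iff)

text \<open>Each \<open>D\<^sub>k\<close> is an \<open>L\<^sup>2\<close> contraction, so the closure acts coordinatewise by the same formula.\<close>
lemma D_graph_coord:
  assumes "(F, U) \<in> D_graph M P X"
  shows "AE \<omega> in P. U (k, \<omega>) = D_coord M P X k F \<omega>"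
proof -
  obtain S where F: "F \<in> L2_space (P_X M P X)" and U: "U \<in> L2_space (kappa_P_X M P X)"
    and S: "\<And>m. S m \<in> D_core M P X"
    and SF: "(\<lambda>m. \<integral>\<omega>. (S m \<omega> - F \<omega>)\<^sup>2 \<partial>P) \<longlonglongrightarrow> 0"
    and sum: "\<And>m. summable (\<lambda>k. \<integral>\<omega>. (D_coord M P X k (S m) \<omega> - U (k, \<omega>))\<^sup>2 \<partial>P)"
    and SU: "(\<lambda>m. \<Sum>k. \<integral>\<omega>. (D_coord M P X k (S m) \<omega> - U (k, \<omega>))\<^sup>2 \<partial>P) \<longlonglongrightarrow> 0"
    using assms by (rule D_graphD) blast
  have FP: "F \<in> L2_space P" and SP: "S m \<in> L2_space P" for m
    using F D_core_P_X[OF S] by (simp_all add: L2_space_P_X_iff)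
  have UP: "(\<lambda>\<omega>. U (k, \<omega>)) \<in> L2_space P"
    using U by (rule L2_space_kappa_P_XD)
  note [measurable] = FP[THEN L2_space_measurable] SP[THEN L2_space_measurable] UP[THEN L2_space_measurable]
  let ?d = "\<lambda>\<omega>. U (k, \<omega>) - D_coord M P X k F \<omega>"
  have d: "?d \<in> L2_space P"
    using UP D_coord_L2[OF FP] by (rule L2_space_diff)
  \<comment> \<open>Triangle inequality through D_k (S m). The left side is free of m and the right
    side tends to 0.\<close>
  have le: "(\<integral>\<omega>. (?d \<omega>)\<^sup>2 \<partial>P) \<le>
      2 * (\<integral>\<omega>. (S m \<omega> - F \<omega>)\<^sup>2 \<partial>P) + 2 * (\<Sum>k. \<integral>\<omega>. (D_coord M P X k (S m) \<omega> - U (k, \<omega>))\<^sup>2 \<partial>P)" for m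
  proof -
    let ?D = "D_coord M P X k"
    have "(\<integral>\<omega>. (?d \<omega>)\<^sup>2 \<partial>P) = (\<integral>\<omega>. (1 * (?D (S m) \<omega> - ?D F \<omega>) + (-1) * (?D (S m) \<omega> - U (k, \<omega>)))\<^sup>2 \<partial>P)"
      by simp
    also have "\<dots> \<le> 2 * 1\<^sup>2 * (\<integral>\<omega>. (?D (S m) \<omega> - ?D F \<omega>)\<^sup>2 \<partial>P) + 2 * (-1)\<^sup>2 * (\<integral>\<omega>. (?D (S m) \<omega> - U (k, \<omega>))\<^sup>2 \<partial>P)"
      using SP FP UP by (intro integral_square_lincomb_le L2_space_diff D_coord_L2)
    also have "(\<integral>\<omega>. (?D (S m) \<omega> - ?D F \<omega>)\<^sup>2 \<partial>P) = (\<integral>\<omega>. (?D (\<lambda>\<omega>. S m \<omega> - F \<omega>) \<omega>)\<^sup>2 \<partial>P)"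
    proof (rule integral_cong_AE)
      show "AE \<omega> in P. (?D (S m) \<omega> - ?D F \<omega>)\<^sup>2 = (?D (\<lambda>\<omega>. S m \<omega> - F \<omega>) \<omega>)\<^sup>2"
        using D_coord_diff[OF SP[of m] FP, of k] by eventually_elim simp
    qed measurable
    also have "\<dots> \<le> (\<integral>\<omega>. (S m \<omega> - F \<omega>)\<^sup>2 \<partial>P)"
      using SP FP by (intro integral_D_coord_square_le L2_space_diff)
    also have "(\<integral>\<omega>. (?D (S m) \<omega> - U (k, \<omega>))\<^sup>2 \<partial>P) \<le> (\<Sum>k. \<integral>\<omega>. (D_coord M P X k (S m) \<omega> - U (k, \<omega>))\<^sup>2 \<partial>P)"
      using sum_le_suminf[OF sum, of "{k}"] by simp
    finally show ?thesis by simp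
  qed
  have "(\<integral>\<omega>. (?d \<omega>)\<^sup>2 \<partial>P) \<le> 2 * 0 + 2 * 0"
    by (rule LIMSEQ_le_const[OF tendsto_add[OF tendsto_mult_left[OF SF] tendsto_mult_left[OF SU]]])
      (use le in blast)
  then have "(\<integral>\<omega>. (?d \<omega>)\<^sup>2 \<partial>P) = 0"
    by (simp add: antisym)
  then have "AE \<omega> in P. (?d \<omega>)\<^sup>2 = 0"
    using L2_space_integrable_square[OF d] by (subst (asm) integral_nonneg_eq_0_iff_AE) auto
  then show ?thesis
    by eventually_elim simp
qed

text \<open>The Riesz argument requires \<open>dom_D\<close> to be a subspace. The combined
  approximating sequences stay in the core, and almost everywhere linearity of D_k suffices because
  only integrals are compared.\<close>

lemma D_graph_lincomb:
  assumes "(F, U) \<in> D_graph M P X" "(G, V) \<in> D_graph M P X"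
  shows "((\<lambda>\<omega>. a * F \<omega> + b * G \<omega>), (\<lambda>z. a * U z + b * V z)) \<in> D_graph M P X"
proof -
  obtain S where F: "F \<in> L2_space (P_X M P X)" and U: "U \<in> L2_space (kappa_P_X M P X)"
    and S: "\<And>m. S m \<in> D_core M P X"
    and SF: "(\<lambda>m. \<integral>\<omega>. (S m \<omega> - F \<omega>)\<^sup>2 \<partial>P) \<longlonglongrightarrow> 0"
    and sumS: "\<And>m. summable (\<lambda>k. \<integral>\<omega>. (D_coord M P X k (S m) \<omega> - U (k, \<omega>))\<^sup>2 \<partial>P)"
    and SU: "(\<lambda>m. \<Sum>k. \<integral>\<omega>. (D_coord M P X k (S m) \<omega> - U (k, \<omega>))\<^sup>2 \<partial>P) \<longlonglongrightarrow> 0"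
    using assms(1) by (rule D_graphD) blast
  obtain T where G: "G \<in> L2_space (P_X M P X)" and V: "V \<in> L2_space (kappa_P_X M P X)"
    and T: "\<And>m. T m \<in> D_core M P X"
    and TG: "(\<lambda>m. \<integral>\<omega>. (T m \<omega> - G \<omega>)\<^sup>2 \<partial>P) \<longlonglongrightarrow> 0"
    and sumT: "\<And>m. summable (\<lambda>k. \<integral>\<omega>. (D_coord M P X k (T m) \<omega> - V (k, \<omega>))\<^sup>2 \<partial>P)"
    and TV: "(\<lambda>m. \<Sum>k. \<integral>\<omega>. (D_coord M P X k (T m) \<omega> - V (k, \<omega>))\<^sup>2 \<partial>P) \<longlonglongrightarrow> 0"
    using assms(2) by (rule D_graphD) blast
  note P = F[unfolded L2_space_P_X_iff, THEN conjunct2] G[unfolded L2_space_P_X_iff, THEN conjunct2]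
    D_core_P_X[OF S, unfolded L2_space_P_X_iff, THEN conjunct2]
    D_core_P_X[OF T, unfolded L2_space_P_X_iff, THEN conjunct2]
  note UV = L2_space_kappa_P_XD(1)[OF U] L2_space_kappa_P_XD(1)[OF V]
  note [measurable] = P[THEN L2_space_measurable] UV[THEN L2_space_measurable]
  let ?R = "\<lambda>m \<omega>. a * S m \<omega> + b * T m \<omega>"
  let ?H = "\<lambda>\<omega>. a * F \<omega> + b * G \<omega>" and ?W = "\<lambda>z. a * U z + b * V z"
  have W: "?W \<in> L2_space (kappa_P_X M P X)"
    using U V by (rule L2_space_lincomb)
  have R: "?R m \<in> D_core M P X" for m
    using S T by (rule D_core_lincomb)
  show ?thesis
  proof (rule D_graphI)
    show "?H \<in> L2_space (P_X M P X)"
      using F G by (rule L2_space_lincomb)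
    show "(\<lambda>m. \<integral>\<omega>. (?R m \<omega> - ?H \<omega>)\<^sup>2 \<partial>P) \<longlonglongrightarrow> 0"
    proof (rule Lim_null_comparison)
      show "(\<lambda>m. 2 * a\<^sup>2 * (\<integral>\<omega>. (S m \<omega> - F \<omega>)\<^sup>2 \<partial>P) + 2 * b\<^sup>2 * (\<integral>\<omega>. (T m \<omega> - G \<omega>)\<^sup>2 \<partial>P)) \<longlonglongrightarrow> 0"
        by (intro tendsto_add_zero tendsto_mult_right_zero SF TG)
      have "(\<integral>\<omega>. (?R m \<omega> - ?H \<omega>)\<^sup>2 \<partial>P) = (\<integral>\<omega>. (a * (S m \<omega> - F \<omega>) + b * (T m \<omega> - G \<omega>))\<^sup>2 \<partial>P)" for m
        by (simp add: algebra_simps)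
      then show "\<forall>\<^sub>F m in sequentially. norm (\<integral>\<omega>. (?R m \<omega> - ?H \<omega>)\<^sup>2 \<partial>P) \<le>
          2 * a\<^sup>2 * (\<integral>\<omega>. (S m \<omega> - F \<omega>)\<^sup>2 \<partial>P) + 2 * b\<^sup>2 * (\<integral>\<omega>. (T m \<omega> - G \<omega>)\<^sup>2 \<partial>P)"
        using P by (simp add: integral_square_lincomb_le L2_space_diff)
    qed
    let ?s = "\<lambda>m k. \<integral>\<omega>. (D_coord M P X k (S m) \<omega> - U (k, \<omega>))\<^sup>2 \<partial>P"
    let ?t = "\<lambda>m k. \<integral>\<omega>. (D_coord M P X k (T m) \<omega> - V (k, \<omega>))\<^sup>2 \<partial>P"
    let ?r = "\<lambda>m k. \<integral>\<omega>. (D_coord M P X k (?R m) \<omega> - ?W (k, \<omega>))\<^sup>2 \<partial>P"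
    have r_le: "?r m k \<le> 2 * a\<^sup>2 * ?s m k + 2 * b\<^sup>2 * ?t m k" for m k
    proof -
      have "?r m k = (\<integral>\<omega>. (a * (D_coord M P X k (S m) \<omega> - U (k, \<omega>)) + b * (D_coord M P X k (T m) \<omega> - V (k, \<omega>)))\<^sup>2 \<partial>P)"
      proof (rule integral_cong_AE)
        show "AE \<omega> in P. (D_coord M P X k (?R m) \<omega> - ?W (k, \<omega>))\<^sup>2 =
            (a * (D_coord M P X k (S m) \<omega> - U (k, \<omega>)) + b * (D_coord M P X k (T m) \<omega> - V (k, \<omega>)))\<^sup>2"
          using D_coord_lincomb[OF P(3)[of m] P(4)[of m], of k a b] by eventually_elim (simp add: algebra_simps)
      qed measurable
      also have "\<dots> \<le> 2 * a\<^sup>2 * ?s m k + 2 * b\<^sup>2 * ?t m k"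
        using P UV by (intro integral_square_lincomb_le L2_space_diff D_coord_L2)
      finally show ?thesis .
    qed
    show "(\<lambda>m. \<Sum>k. ?r m k) \<longlonglongrightarrow> 0"
    proof (rule Lim_null_comparison)
      show "(\<lambda>m. 2 * a\<^sup>2 * (\<Sum>k. ?s m k) + 2 * b\<^sup>2 * (\<Sum>k. ?t m k)) \<longlonglongrightarrow> 0"
        by (intro tendsto_add_zero tendsto_mult_right_zero SU TV)
      have "norm (\<Sum>k. ?r m k) \<le> 2 * a\<^sup>2 * (\<Sum>k. ?s m k) + 2 * b\<^sup>2 * (\<Sum>k. ?t m k)" for m
      proof -
        have r: "summable (?r m)"
          using DD_diff_L2[OF R W] by (simp add: L2_space_kappa_P_X)
        have "(\<Sum>k. ?r m k) \<le> (\<Sum>k. 2 * a\<^sup>2 * ?s m k + 2 * b\<^sup>2 * ?t m k)"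
          using r_le r sumS sumT by (intro suminf_le summable_add summable_mult)
        also have "\<dots> = 2 * a\<^sup>2 * (\<Sum>k. ?s m k) + 2 * b\<^sup>2 * (\<Sum>k. ?t m k)"
          using sumS sumT by (simp add: suminf_add[symmetric] summable_mult suminf_mult)
        finally show ?thesis
          using suminf_nonneg[OF r] by simp
      qed
      then show "\<forall>\<^sub>F m in sequentially. norm (\<Sum>k. ?r m k) \<le> 2 * a\<^sup>2 * (\<Sum>k. ?s m k) + 2 * b\<^sup>2 * (\<Sum>k. ?t m k)"
        by simp
    qed
  qed (rule W R)+
qed

lemma dom_D_lincomb:
  "F \<in> dom_D M P X \<Longrightarrow> G \<in> dom_D M P X \<Longrightarrow> (\<lambda>\<omega>. a * F \<omega> + b * G \<omega>) \<in> dom_D M P X"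
  unfolding dom_D_def using D_graph_lincomb by blast

lemma malliavin_D_graph: "F \<in> dom_D M P X \<Longrightarrow> (F, malliavin_D M P X F) \<in> D_graph M P X"
  unfolding dom_D_def malliavin_D_def by (auto intro: someI[of "\<lambda>U. (F, U) \<in> D_graph M P X"])

text \<open>Square-summability passes from an abstract \<open>U\<close> in the closure to F -
  E[F | G_k] itself. Convergence of the pairing and of the series in \<open>Gamma0\<close> both come
  from here.\<close>

lemma summable_D_coord_square:
  assumes "F \<in> dom_D M P X"
  shows "summable (\<lambda>k. \<integral>\<omega>. (D_coord M P X k F \<omega>)\<^sup>2 \<partial>P)"
proof -
  obtain U where FU: "(F, U) \<in> D_graph M P X"
    using assms by (auto simp: dom_D_def)
  have [measurable]: "F \<in> borel_measurable P" "(\<lambda>\<omega>. U (k, \<omega>)) \<in> borel_measurable P" for k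
    using dom_D_L2[OF assms] L2_space_kappa_P_XD(1)[OF D_graph_L2(2)[OF FU]]
    by (simp_all add: L2_space_P_X_iff L2_space_measurable)
  have "(\<integral>\<omega>. (D_coord M P X k F \<omega>)\<^sup>2 \<partial>P) = (\<integral>\<omega>. (U (k, \<omega>))\<^sup>2 \<partial>P)" for k
  proof (rule integral_cong_AE)
    show "AE \<omega> in P. (D_coord M P X k F \<omega>)\<^sup>2 = (U (k, \<omega>))\<^sup>2"
      using D_graph_coord[OF FU, of k] by eventually_elim simp
  qed measurable
  then show ?thesis
    using L2_space_kappa_P_XD(2)[OF D_graph_L2(2)[OF FU]] by simp
qed

section \<open>Divergence and generator\<close>

lemma summable_D_pairing:
  assumes F: "F \<in> dom_D M P X" and U: "U \<in> L2_space (kappa_P_X M P X)"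
  shows "summable (\<lambda>k. \<integral>\<omega>. D_coord M P X k F \<omega> * U (k, \<omega>) \<partial>P)"
proof (rule summable_comparison_test')
  show "summable (\<lambda>k. (\<integral>\<omega>. (D_coord M P X k F \<omega>)\<^sup>2 \<partial>P) + (\<integral>\<omega>. (U (k, \<omega>))\<^sup>2 \<partial>P))"
    using summable_D_coord_square[OF F] L2_space_kappa_P_XD(2)[OF U] by (rule summable_add)
  fix k
  have "\<bar>\<integral>\<omega>. D_coord M P X k F \<omega> * U (k, \<omega>) \<partial>P\<bar> \<le> (\<integral>\<omega>. \<bar>D_coord M P X k F \<omega> * U (k, \<omega>)\<bar> \<partial>P)"
    by (rule integral_abs_bound)
  also have "\<dots> \<le> (\<integral>\<omega>. (D_coord M P X k F \<omega>)\<^sup>2 \<partial>P) + (\<integral>\<omega>. (U (k, \<omega>))\<^sup>2 \<partial>P)"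
    using dom_D_L2[OF F] L2_space_kappa_P_XD(1)[OF U]
    by (intro abs_integral_mult_le D_coord_L2) (simp_all add: L2_space_P_X_iff)
  finally show "norm (\<integral>\<omega>. D_coord M P X k F \<omega> * U (k, \<omega>) \<partial>P) \<le>
      (\<integral>\<omega>. (D_coord M P X k F \<omega>)\<^sup>2 \<partial>P) + (\<integral>\<omega>. (U (k, \<omega>))\<^sup>2 \<partial>P)"
    by simp
qed

lemma D_pairing_lincomb:
  assumes F: "F \<in> dom_D M P X" and G: "G \<in> dom_D M P X" and U: "U \<in> L2_space (kappa_P_X M P X)"
  shows "D_pairing M P X (\<lambda>\<omega>. a * F \<omega> + b * G \<omega>) U = a * D_pairing M P X F U + b * D_pairing M P X G U"
proof -
  have FP: "F \<in> L2_space P" and GP: "G \<in> L2_space P"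
    using F G by (auto dest: dom_D_L2 simp: L2_space_P_X_iff)
  have UP: "(\<lambda>\<omega>. U (k, \<omega>)) \<in> L2_space P" for k
    using U by (rule L2_space_kappa_P_XD)
  note [measurable] = FP[THEN L2_space_measurable] GP[THEN L2_space_measurable] UP[THEN L2_space_measurable]
  have "(\<integral>\<omega>. D_coord M P X k (\<lambda>\<omega>. a * F \<omega> + b * G \<omega>) \<omega> * U (k, \<omega>) \<partial>P) =
      a * (\<integral>\<omega>. D_coord M P X k F \<omega> * U (k, \<omega>) \<partial>P) + b * (\<integral>\<omega>. D_coord M P X k G \<omega> * U (k, \<omega>) \<partial>P)" for k
  proof -
    have "(\<integral>\<omega>. D_coord M P X k (\<lambda>\<omega>. a * F \<omega> + b * G \<omega>) \<omega> * U (k, \<omega>) \<partial>P) =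
        (\<integral>\<omega>. a * (D_coord M P X k F \<omega> * U (k, \<omega>)) + b * (D_coord M P X k G \<omega> * U (k, \<omega>)) \<partial>P)"
    proof (rule integral_cong_AE)
      show "AE \<omega> in P. D_coord M P X k (\<lambda>\<omega>. a * F \<omega> + b * G \<omega>) \<omega> * U (k, \<omega>) =
          a * (D_coord M P X k F \<omega> * U (k, \<omega>)) + b * (D_coord M P X k G \<omega> * U (k, \<omega>))"
        using D_coord_lincomb[OF FP GP, of k a b] by eventually_elim (simp add: algebra_simps)
    qed measurable
    then show ?thesis
      using FP GP UP by (simp add: L2_space_integrable_mult D_coord_L2)
  qed
  then show ?thesis
    using summable_D_pairing[OF F U] summable_D_pairing[OF G U]
    by (simp add: D_pairing_def suminf_add[symmetric] summable_mult suminf_mult)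
qed

text \<open>Some V with the property defining \<open>divergence\<close> must exist before the choice
  says anything. Riesz is applied over \<open>P_X\<close>, so that V is sigma(X)-measurable as the
  definition demands.\<close>

lemma integral_mult_divergence:
  assumes F: "F \<in> dom_D M P X" and U: "U \<in> dom_delta M P X"
  shows "(\<integral>\<omega>. F \<omega> * divergence M P X U \<omega> \<partial>P) = D_pairing M P X F U"
proof -
  interpret N: prob_space "P_X M P X"
    by (rule prob_space_P_X)
  obtain C where UL2: "U \<in> L2_space (kappa_P_X M P X)"
    and C: "\<And>F. F \<in> dom_D M P X \<Longrightarrow> \<bar>D_pairing M P X F U\<bar> \<le> C * L2_norm (P_X M P X) F"
    using U by (auto simp: dom_delta_def)
  obtain V where V: "V \<in> L2_space (P_X M P X)"
    and FV: "\<And>F. F \<in> dom_D M P X \<Longrightarrow> (\<integral>\<omega>. F \<omega> * V \<omega> \<partial>P_X M P X) = D_pairing M P X F U"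
  proof (rule N.L2_Riesz_representation[of "dom_D M P X" "\<lambda>F. D_pairing M P X F U" C])
    show "dom_D M P X \<subseteq> L2_space (P_X M P X)"
      using dom_D_L2 by blast
    show "dom_D M P X \<noteq> {}"
      using F by blast
  qed (use C UL2 dom_D_lincomb D_pairing_lincomb in auto)
  have "(\<integral>\<omega>. F \<omega> * V \<omega> \<partial>P) = D_pairing M P X F U" if F: "F \<in> dom_D M P X" for F
    unfolding FV[OF F, symmetric] using L2_space_measurable[OF V] L2_space_measurable[OF dom_D_L2[OF F]]
    by (intro integral_P_X[symmetric]) measurable
  with V have "\<exists>V. V \<in> L2_space (P_X M P X) \<and>
      (\<forall>F \<in> dom_D M P X. (\<integral>\<omega>. F \<omega> * V \<omega> \<partial>P) = D_pairing M P X F U)"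
    by blast
  from someI_ex[OF this] show ?thesis
    using F unfolding divergence_def by blast
qed

lemma integral_mult_OU_generator:
  assumes F: "F \<in> dom_D M P X" and G: "G \<in> dom_L M P X"
  shows "(\<integral>\<omega>. F \<omega> * OU_generator M P X G \<omega> \<partial>P) =
    - (\<Sum>k. \<integral>\<omega>. D_coord M P X k F \<omega> * D_coord M P X k G \<omega> \<partial>P)"
proof -
  have G': "G \<in> dom_D M P X" "malliavin_D M P X G \<in> dom_delta M P X"
    using G by (auto simp: dom_L_def)
  note graph = malliavin_D_graph[OF G'(1)]
  have [measurable]: "F \<in> borel_measurable P" "G \<in> borel_measurable P"
    "(\<lambda>\<omega>. malliavin_D M P X G (k, \<omega>)) \<in> borel_measurable P" for k
    using dom_D_L2[OF F] dom_D_L2[OF G'(1)] L2_space_kappa_P_XD(1)[OF D_graph_L2(2)[OF graph]]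
    by (simp_all add: L2_space_P_X_iff L2_space_measurable)
  have "(\<integral>\<omega>. D_coord M P X k F \<omega> * malliavin_D M P X G (k, \<omega>) \<partial>P) =
      (\<integral>\<omega>. D_coord M P X k F \<omega> * D_coord M P X k G \<omega> \<partial>P)" for k
  proof (rule integral_cong_AE)
    show "AE \<omega> in P. D_coord M P X k F \<omega> * malliavin_D M P X G (k, \<omega>) = D_coord M P X k F \<omega> * D_coord M P X k G \<omega>"
      using D_graph_coord[OF graph, of k] by eventually_elim simp
  qed measurable
  then show ?thesis
    using integral_mult_divergence[OF F G'(2)] by (simp add: OU_generator_def D_pairing_def)
qed

section \<open>Resampling a coordinate\<close>

lemma prob_space_PiM_M: "prob_space (PiM UNIV M)"
  by (intro prob_space_PiM prob_space_M)

lemma resample_measurable [measurable]: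
  "(\<lambda>(x, y). x(k := y)) \<in> PiM UNIV M \<Otimes>\<^sub>M M k \<rightarrow>\<^sub>M PiM UNIV M"
  using measurable_add_dim[of k UNIV M] by simp

lemma distr_resample:
  "distr (PiM UNIV M \<Otimes>\<^sub>M M k) (PiM UNIV M) (\<lambda>(x, y). x(k := y)) = PiM UNIV M"
proof -
  interpret \<mu>: prob_space "PiM UNIV M" by (rule prob_space_PiM_M)
  interpret Mk: prob_space "M k" by (rule prob_space_M)
  interpret pair_sigma_finite "PiM UNIV M" "M k" ..
  interpret swap: pair_sigma_finite "M k" "PiM UNIV M" ..
  have [measurable]: "(\<lambda>(y, x). x(k := y)) \<in> M k \<Otimes>\<^sub>M PiM UNIV M \<rightarrow>\<^sub>M PiM UNIV M"
    using measurable_compose[OF measurable_pair_swap' resample_measurable[of k]]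
    by (simp add: case_prod_beta')
  \<comment> \<open>The index k is inserted into a set that already contains it, so the update
    overwrites a coordinate instead of adding one.\<close>
  have "PiM UNIV M = distr (M k \<Otimes>\<^sub>M PiM UNIV M) (PiM UNIV M) (\<lambda>(y, x). x(k := y))"
    using distr_pair_PiM_eq_PiM[of UNIV M k] prob_space_M by simp
  also have "\<dots> = distr (PiM UNIV M \<Otimes>\<^sub>M M k) (PiM UNIV M) (\<lambda>(x, y). x(k := y))"
    by (subst swap.distr_pair_swap, subst distr_distr) (auto simp: comp_def case_prod_beta')
  finally show ?thesis ..
qed

text \<open>On path space this is the explicit version of E[f(X) | G_k].\<close>

definition section_mean :: "nat \<Rightarrow> ((nat \<Rightarrow> 'a) \<Rightarrow> real) \<Rightarrow> (nat \<Rightarrow> 'a) \<Rightarrow> real" where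
  "section_mean k f x = (\<integral>y. f (x(k := y)) \<partial>M k)"

lemma section_mean_measurable [measurable]:
  assumes [measurable]: "f \<in> borel_measurable (PiM UNIV M)"
  shows "section_mean k f \<in> borel_measurable (PiM UNIV M)"
proof -
  interpret Mk: prob_space "M k" by (rule prob_space_M)
  have "(\<lambda>(x, y). f (x(k := y))) \<in> borel_measurable (PiM UNIV M \<Otimes>\<^sub>M M k)"
    using measurable_compose[OF resample_measurable assms] by (simp add: case_prod_beta')
  then show ?thesis
    unfolding section_mean_def by (rule Mk.borel_measurable_lebesgue_integral)
qed

text \<open>Fubini. Updating a coordinate and forgetting the extra one both carry the product
  measure to \<mu>, so both factors are square-integrable and their product is integrable.\<close>

lemma integral_section_mean_mult:
  assumes f: "f \<in> L2_space (PiM UNIV M)" and g: "g \<in> L2_space (PiM UNIV M)"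
  shows "integrable (PiM UNIV M) (\<lambda>x. section_mean k f x * g x)"
    and "(\<integral>x. section_mean k f x * g x \<partial>PiM UNIV M) =
      (\<integral>z. f ((fst z)(k := snd z)) * g (fst z) \<partial>(PiM UNIV M \<Otimes>\<^sub>M M k))"
proof -
  interpret \<mu>: prob_space "PiM UNIV M" by (rule prob_space_PiM_M)
  interpret Mk: prob_space "M k" by (rule prob_space_M)
  interpret pair_sigma_finite "PiM UNIV M" "M k" ..
  have "(\<lambda>z. f ((fst z)(k := snd z))) \<in> L2_space (PiM UNIV M \<Otimes>\<^sub>M M k)"
    using L2_space_distr[OF resample_measurable distr_resample f, of k] by (simp add: case_prod_beta')
  moreover have "(\<lambda>z. g (fst z)) \<in> L2_space (PiM UNIV M \<Otimes>\<^sub>M M k)"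
    using measurable_fst Mk.distr_pair_fst g by (rule L2_space_distr)
  ultimately have int: "integrable (PiM UNIV M \<Otimes>\<^sub>M M k) (\<lambda>z. f ((fst z)(k := snd z)) * g (fst z))"
    by (rule L2_space_integrable_mult)
  show "integrable (PiM UNIV M) (\<lambda>x. section_mean k f x * g x)"
    using integrable_fst'[OF int] by (simp add: section_mean_def)
  show "(\<integral>x. section_mean k f x * g x \<partial>PiM UNIV M) =
      (\<integral>z. f ((fst z)(k := snd z)) * g (fst z) \<partial>(PiM UNIV M \<Otimes>\<^sub>M M k))"
    using integral_fst'[OF int] by (simp add: section_mean_def)
qed

lemma L2_space_X: "f \<in> L2_space (PiM UNIV M) \<Longrightarrow> (\<lambda>\<omega>. f (X \<omega>)) \<in> L2_space P"
  using X_measurable distr_X by (rule L2_space_distr)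

lemma integral_X:
  fixes f :: "_ \<Rightarrow> real"
  shows "f \<in> borel_measurable (PiM UNIV M) \<Longrightarrow> (\<integral>\<omega>. f (X \<omega>) \<partial>P) = (\<integral>x. f x \<partial>PiM UNIV M)"
  using X_measurable distr_X by (rule integral_distr_same)

text \<open>
  Freezing the \<open>k\<close>-th coordinate at a point \<open>a\<close> turns \<open>X\<close> into a random variable generating
  \<open>\<sigma>(X\<^sub>j, j \<noteq> k)\<close>.
\<close>
lemma cond_exp_section_mean:
  assumes f: "f \<in> L2_space (PiM UNIV M)"
  shows "AE \<omega> in P. real_cond_exp P (sigma_coords M P X (- {k})) (\<lambda>\<omega>. f (X \<omega>)) \<omega> = section_mean k f (X \<omega>)"
proof -
  interpret \<mu>: prob_space "PiM UNIV M" by (rule prob_space_PiM_M)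
  interpret Mk: prob_space "M k" by (rule prob_space_M)
  let ?G = "sigma_coords M P X (- {k})"
  interpret E: finite_measure_subalgebra P ?G
    by (rule finite_measure_subalgebra_sigma_coords)
  have [measurable]: "f \<in> borel_measurable (PiM UNIV M)"
    using f by (rule L2_space_measurable)
  obtain a where a: "a \<in> space (M k)"
    using Mk.not_empty by blast
  define Y where "Y \<omega> = (X \<omega>)(k := a)" for \<omega>
  have freeze [measurable]: "(\<lambda>x. x(k := a)) \<in> PiM UNIV M \<rightarrow>\<^sub>M PiM UNIV M"
    by (rule measurable_fun_upd[where J=UNIV]) (use a in auto)
  have Y_space: "Y \<in> space P \<rightarrow> space (PiM UNIV M)"
    unfolding Y_def using measurable_space[OF freeze] measurable_space[OF X_measurable] by blast
  have Y: "Y \<in> ?G \<rightarrow>\<^sub>M PiM UNIV M"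
  proof -
    have "(\<lambda>\<omega>. Y \<omega> j) \<in> ?G \<rightarrow>\<^sub>M M j" for j
      using a measurable_sigma_coords[of j "- {k}"] by (cases "j = k") (auto simp: Y_def)
    then have "(\<lambda>\<omega> j. Y \<omega> j) \<in> ?G \<rightarrow>\<^sub>M PiM UNIV M"
      using Y_space by (intro measurable_PiM_single') (auto simp: space_PiM)
    then show ?thesis by simp
  qed
  \<comment> \<open>Y determines every coordinate of X except the k-th, so each event of G_k is a
    preimage under Y.\<close>
  have sets_G: "\<exists>B\<in>sets (PiM UNIV M). A = Y -` B \<inter> space P" if "A \<in> sets ?G" for A
  proof -
    have "sets ?G \<subseteq> sets (vimage_algebra (space P) Y (PiM UNIV M))"
    proof (rule sets_sigma_coords_subset)
      fix j assume "j \<in> - {k}"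
      then have "(\<lambda>\<omega>. X \<omega> j) = (\<lambda>\<omega>. Y \<omega> j)"
        by (auto simp: Y_def)
      moreover have [measurable]: "Y \<in> vimage_algebra (space P) Y (PiM UNIV M) \<rightarrow>\<^sub>M PiM UNIV M"
        using Y_space by (rule measurable_vimage_algebra1)
      ultimately show "(\<lambda>\<omega>. X \<omega> j) \<in> vimage_algebra (space P) Y (PiM UNIV M) \<rightarrow>\<^sub>M M j"
        by simp
    qed simp
    then show ?thesis
      using that sets_vimage_algebra2[OF Y_space] by auto
  qed
  show ?thesis
  proof (rule E.real_cond_exp_charact)
    fix A assume "A \<in> sets ?G"
    then obtain B where [measurable]: "B \<in> sets (PiM UNIV M)" and A: "A = Y -` B \<inter> space P"
      using sets_G by blast
    \<comment> \<open>The indicator of A as a function of X. It ignores coordinate k, so resampling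
      that coordinate affects f alone.\<close>
    define h :: "(nat \<Rightarrow> 'a) \<Rightarrow> real" where "h x = indicator B (x(k := a))" for x
    have h_measurable [measurable]: "h \<in> borel_measurable (PiM UNIV M)"
      unfolding h_def by measurable
    have h: "h \<in> L2_space (PiM UNIV M)"
      by (rule L2_spaceI) (auto intro!: \<mu>.integrable_const_bound[where B=1] simp: h_def indicator_def)
    have h_X: "indicat_real A \<omega> = h (X \<omega>)" if "\<omega> \<in> space P" for \<omega>
      using that by (simp add: A h_def Y_def indicator_def)
    have h_upd: "h (x(k := y)) = h x" for x y
      by (simp add: h_def)
    have "(\<integral>\<omega>\<in>A. f (X \<omega>) \<partial>P) = (\<integral>\<omega>. f (X \<omega>) * h (X \<omega>) \<partial>P)"
      unfolding set_lebesgue_integral_def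
      by (intro Bochner_Integration.integral_cong) (auto simp: h_X)
    also have "\<dots> = (\<integral>x. f x * h x \<partial>PiM UNIV M)"
      by (rule integral_X) measurable
    also have "\<dots> = (\<integral>z. f ((fst z)(k := snd z)) * h ((fst z)(k := snd z)) \<partial>(PiM UNIV M \<Otimes>\<^sub>M M k))"
      using integral_distr_same[OF resample_measurable distr_resample, of "\<lambda>x. f x * h x" k]
      by (simp add: case_prod_beta')
    also have "\<dots> = (\<integral>x. section_mean k f x * h x \<partial>PiM UNIV M)"
      unfolding integral_section_mean_mult(2)[OF f h] h_upd ..
    also have "\<dots> = (\<integral>\<omega>. section_mean k f (X \<omega>) * h (X \<omega>) \<partial>P)"
      by (rule integral_X[symmetric]) measurable
    also have "\<dots> = (\<integral>\<omega>\<in>A. section_mean k f (X \<omega>) \<partial>P)"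
      unfolding set_lebesgue_integral_def
      by (intro Bochner_Integration.integral_cong) (auto simp: h_X)
    finally show "(\<integral>\<omega>\<in>A. f (X \<omega>) \<partial>P) = (\<integral>\<omega>\<in>A. section_mean k f (X \<omega>) \<partial>P)" .
  next
    show "integrable P (\<lambda>\<omega>. f (X \<omega>))"
      using f by (intro L2_space_integrable L2_space_X)
    have "(\<lambda>_. 1) \<in> L2_space (PiM UNIV M)"
      by (rule L2_spaceI) auto
    from integral_section_mean_mult(1)[OF f this, of k] have "integrable (PiM UNIV M) (section_mean k f)"
      by simp
    then show "integrable P (\<lambda>\<omega>. section_mean k f (X \<omega>))"
      by (intro integrable_distr[OF X_measurable]) (simp add: distr_X)
    \<comment> \<open>The section mean overwrites coordinate k, hence may be evaluated at Y, which
      is G_k-measurable.\<close>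
    have "section_mean k f (X \<omega>) = section_mean k f (Y \<omega>)" for \<omega>
      by (simp add: section_mean_def Y_def)
    then show "(\<lambda>\<omega>. section_mean k f (X \<omega>)) \<in> borel_measurable ?G"
      using measurable_compose[OF Y section_mean_measurable] by simp
  qed
qed

text \<open>The existence behind the choice in \<open>representative\<close>: sigma(X) is a
  pull-back sigma-algebra, so F factors through X, and the law of X carries square-integrability
  over to \<mu>.\<close>

lemma is_representative_representative:
  assumes F: "F \<in> L2_space (P_X M P X)"
  shows "is_representative M P X F (representative M P X F)"
proof -
  have "F \<in> borel_measurable (vimage_algebra (space P) X (PiM UNIV M))"
    using L2_space_measurable[OF F] by (simp add: borel_measurable_P_X flip: sigma_X_def)
  moreover have "X \<in> space P \<rightarrow> space (PiM UNIV M)"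
    using measurable_space[OF X_measurable] by blast
  ultimately obtain f where f: "f \<in> borel_measurable (PiM UNIV M)" and F_f: "\<And>\<omega>. \<omega> \<in> space P \<Longrightarrow> F \<omega> = f (X \<omega>)"
    by (rule borel_measurable_vimage_algebra_factor) blast
  have "integrable P (\<lambda>\<omega>. (f (X \<omega>))\<^sup>2)"
    using F F_f by (subst Bochner_Integration.integrable_cong[OF refl, where g="\<lambda>\<omega>. (F \<omega>)\<^sup>2"])
      (auto simp: L2_space_P_X_iff dest: L2_space_integrable_square)
  then have "integrable (PiM UNIV M) (\<lambda>x. (f x)\<^sup>2)"
    using f by (subst distr_X[symmetric], subst integrable_distr_eq) auto
  with f have "is_representative M P X F f"
    using F_f by (auto simp: is_representative_def intro: L2_spaceI)
  then show ?thesis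
    unfolding representative_def by (rule someI[of "is_representative M P X F"])
qed

end

section \<open>The independent copy and the carre du champ \<open>Gamma0\<close>\<close>

locale coord_sequence_copy = coord_sequence P M X
  for P :: "'w measure" and M :: "nat \<Rightarrow> 'a measure" and X :: "'w \<Rightarrow> nat \<Rightarrow> 'a" +
  fixes X' :: "'w \<Rightarrow> nat \<Rightarrow> 'a"
  assumes distr_X': "distr P (PiM UNIV M) X' = PiM UNIV M"
    and indep: "indep_var (PiM UNIV M) X (PiM UNIV M) X'"
begin

lemma X'_measurable [measurable]: "X' \<in> P \<rightarrow>\<^sub>M PiM UNIV M"
  using indep by (rule indep_var_rv2)

text \<open>The joint law of the two sequences, projected to coordinate k in the second one. It
  turns resampling on the probability space into the update map on the product space.\<close>

lemma distr_X_X':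
  "distr P (PiM UNIV M \<Otimes>\<^sub>M M k) (\<lambda>\<omega>. (X \<omega>, X' \<omega> k)) = PiM UNIV M \<Otimes>\<^sub>M M k"
proof -
  have k': "distr (PiM UNIV M) (M k) (\<lambda>x. x k) = M k"
    by (rule distr_PiM_component) (auto intro: prob_space_M)
  interpret Mk: prob_space "M k" by (rule prob_space_M)
  have [measurable]: "(\<lambda>x. x k) \<in> PiM UNIV M \<rightarrow>\<^sub>M M k"
    by measurable
  have law: "distr P (PiM UNIV M \<Otimes>\<^sub>M PiM UNIV M) (\<lambda>\<omega>. (X \<omega>, X' \<omega>)) = distr P (PiM UNIV M) X \<Otimes>\<^sub>M distr P (PiM UNIV M) X'"
    using indep by (simp add: indep_var_distribution_eq)
  have "distr P (PiM UNIV M \<Otimes>\<^sub>M M k) (\<lambda>\<omega>. (X \<omega>, X' \<omega> k)) =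
      distr (distr P (PiM UNIV M \<Otimes>\<^sub>M PiM UNIV M) (\<lambda>\<omega>. (X \<omega>, X' \<omega>))) (PiM UNIV M \<Otimes>\<^sub>M M k) (\<lambda>(x, y). (x, y k))"
    by (subst distr_distr) (auto simp: comp_def)
  also have "\<dots> = distr (PiM UNIV M \<Otimes>\<^sub>M PiM UNIV M) (PiM UNIV M \<Otimes>\<^sub>M M k) (\<lambda>(x, y). (x, y k))"
    unfolding law distr_X distr_X' ..
  also have "\<dots> = distr (PiM UNIV M) (PiM UNIV M) (\<lambda>x. x) \<Otimes>\<^sub>M distr (PiM UNIV M) (M k) (\<lambda>y. y k)"
    by (rule pair_measure_distr[symmetric]) (simp_all add: k' Mk.sigma_finite_measure_axioms)
  also have "\<dots> = PiM UNIV M \<Otimes>\<^sub>M M k"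
    by (simp add: k' distr_id2)
  finally show ?thesis .
qed

lemma replace_coord_eq: "replace_coord X X' k = (\<lambda>(x, y). x(k := y)) \<circ> (\<lambda>\<omega>. (X \<omega>, X' \<omega> k))"
  by (auto simp: replace_coord_def)

lemma replace_coord_measurable [measurable]: "replace_coord X X' k \<in> P \<rightarrow>\<^sub>M PiM UNIV M"
  unfolding replace_coord_eq by (rule measurable_comp[OF _ resample_measurable]) measurable

lemma distr_replace_coord: "distr P (PiM UNIV M) (replace_coord X X' k) = PiM UNIV M"
proof -
  have "distr P (PiM UNIV M) (replace_coord X X' k) =
      distr (distr P (PiM UNIV M \<Otimes>\<^sub>M M k) (\<lambda>\<omega>. (X \<omega>, X' \<omega> k))) (PiM UNIV M) (\<lambda>(x, y). x(k := y))"
    unfolding replace_coord_eq by (rule distr_distr[symmetric]) measurable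
  then show ?thesis
    by (simp only: distr_X_X' distr_resample)
qed

text \<open>Integrating out the new coordinate first replaces f(X^(k)) by E[f(X) | G_k]; then g(X)
  may be projected as well. In this symmetric form the two mixed terms of the next expansion
  coincide.\<close>

lemma integral_replace_coord_mult:
  assumes f: "f \<in> L2_space (PiM UNIV M)" and g: "g \<in> L2_space (PiM UNIV M)"
  defines "E \<equiv> \<lambda>k. real_cond_exp P (sigma_coords M P X (- {k}))"
  shows "(\<integral>\<omega>. f (replace_coord X X' k \<omega>) * g (X \<omega>) \<partial>P) =
    (\<integral>\<omega>. E k (\<lambda>\<omega>. f (X \<omega>)) \<omega> * E k (\<lambda>\<omega>. g (X \<omega>)) \<omega> \<partial>P)"
proof -
  interpret E: finite_measure_subalgebra P "sigma_coords M P X (- {k})"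
    by (rule finite_measure_subalgebra_sigma_coords)
  note [measurable] = f[THEN L2_space_measurable] g[THEN L2_space_measurable]
  have [measurable]: "(\<lambda>z. f ((fst z)(k := snd z))) \<in> borel_measurable (PiM UNIV M \<Otimes>\<^sub>M M k)"
    using measurable_compose[OF resample_measurable L2_space_measurable[OF f]] by (simp add: case_prod_beta')
  have "(\<integral>\<omega>. f (replace_coord X X' k \<omega>) * g (X \<omega>) \<partial>P) =
      (\<integral>z. f ((fst z)(k := snd z)) * g (fst z) \<partial>distr P (PiM UNIV M \<Otimes>\<^sub>M M k) (\<lambda>\<omega>. (X \<omega>, X' \<omega> k)))"
    by (subst integral_distr) (auto simp: replace_coord_def)
  also have "\<dots> = (\<integral>x. section_mean k f x * g x \<partial>PiM UNIV M)"
    unfolding distr_X_X' integral_section_mean_mult(2)[OF f g] ..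
  also have "\<dots> = (\<integral>\<omega>. section_mean k f (X \<omega>) * g (X \<omega>) \<partial>P)"
    by (rule integral_X[symmetric]) measurable
  also have "\<dots> = (\<integral>\<omega>. g (X \<omega>) * E k (\<lambda>\<omega>. f (X \<omega>)) \<omega> \<partial>P)"
  proof (rule integral_cong_AE)
    show "AE \<omega> in P. section_mean k f (X \<omega>) * g (X \<omega>) = g (X \<omega>) * E k (\<lambda>\<omega>. f (X \<omega>)) \<omega>"
      unfolding E_def using cond_exp_section_mean[OF f, of k] by eventually_elim simp
  qed (auto simp: E_def)
  also have "\<dots> = (\<integral>\<omega>. E k (\<lambda>\<omega>. g (X \<omega>)) \<omega> * E k (\<lambda>\<omega>. f (X \<omega>)) \<omega> \<partial>P)"
    unfolding E_def using g f by (intro E.integral_cond_exp_mult L2_space_X)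
  finally show ?thesis
    by (simp add: mult.commute)
qed

lemma replace_coord_diff_L2:
  assumes "f \<in> L2_space (PiM UNIV M)"
  shows "(\<lambda>\<omega>. f (replace_coord X X' k \<omega>) - f (X \<omega>)) \<in> L2_space P"
  using assms L2_space_distr[OF replace_coord_measurable distr_replace_coord assms]
  by (intro L2_space_diff L2_space_X)

lemma integral_replace_coord_diff_mult:
  assumes f: "f \<in> L2_space (PiM UNIV M)" and g: "g \<in> L2_space (PiM UNIV M)"
  shows "(\<integral>\<omega>. (f (replace_coord X X' k \<omega>) - f (X \<omega>)) * (g (replace_coord X X' k \<omega>) - g (X \<omega>)) \<partial>P) =
    2 * (\<integral>\<omega>. D_coord M P X k (\<lambda>\<omega>. f (X \<omega>)) \<omega> * D_coord M P X k (\<lambda>\<omega>. g (X \<omega>)) \<omega> \<partial>P)"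
proof -
  note [measurable] = f[THEN L2_space_measurable] g[THEN L2_space_measurable]
  let ?X = "replace_coord X X' k"
  note fX = L2_space_X[OF f] and gX = L2_space_X[OF g]
  note f' = L2_space_distr[OF replace_coord_measurable distr_replace_coord f, of k]
    and g' = L2_space_distr[OF replace_coord_measurable distr_replace_coord g, of k]
  let ?c = "\<integral>\<omega>. real_cond_exp P (sigma_coords M P X (- {k})) (\<lambda>\<omega>. f (X \<omega>)) \<omega> *
    real_cond_exp P (sigma_coords M P X (- {k})) (\<lambda>\<omega>. g (X \<omega>)) \<omega> \<partial>P"
  have "(\<integral>\<omega>. (f (?X \<omega>) - f (X \<omega>)) * (g (?X \<omega>) - g (X \<omega>)) \<partial>P) =
      (\<integral>\<omega>. f (?X \<omega>) * g (?X \<omega>) - f (?X \<omega>) * g (X \<omega>) - g (?X \<omega>) * f (X \<omega>) + f (X \<omega>) * g (X \<omega>) \<partial>P)"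
    by (intro Bochner_Integration.integral_cong) (auto simp: algebra_simps)
  also have "\<dots> = (\<integral>\<omega>. f (?X \<omega>) * g (?X \<omega>) \<partial>P) - (\<integral>\<omega>. f (?X \<omega>) * g (X \<omega>) \<partial>P)
      - (\<integral>\<omega>. g (?X \<omega>) * f (X \<omega>) \<partial>P) + (\<integral>\<omega>. f (X \<omega>) * g (X \<omega>) \<partial>P)"
    using L2_space_integrable_mult[OF f' g'] L2_space_integrable_mult[OF f' gX]
      L2_space_integrable_mult[OF g' fX] L2_space_integrable_mult[OF fX gX] by simp
  also have "(\<integral>\<omega>. f (?X \<omega>) * g (?X \<omega>) \<partial>P) = (\<integral>\<omega>. f (X \<omega>) * g (X \<omega>) \<partial>P)"
    using integral_distr_same[OF replace_coord_measurable distr_replace_coord, of "\<lambda>x. f x * g x" k]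
      integral_X[of "\<lambda>x. f x * g x"] by simp
  also have "(\<integral>\<omega>. f (?X \<omega>) * g (X \<omega>) \<partial>P) = ?c"
    using f g by (rule integral_replace_coord_mult)
  also have "(\<integral>\<omega>. g (?X \<omega>) * f (X \<omega>) \<partial>P) = ?c"
    using integral_replace_coord_mult[OF g f, of k] by (simp add: mult.commute)
  finally show ?thesis
    using integral_D_coord_mult[OF fX gX, of k] by simp
qed

lemma D_coord_cong_AE:
  assumes "AE \<omega> in P. f \<omega> = g \<omega>" and [measurable]: "f \<in> borel_measurable P" "g \<in> borel_measurable P"
  shows "AE \<omega> in P. D_coord M P X k f \<omega> = D_coord M P X k g \<omega>"
proof -
  interpret E: finite_measure_subalgebra P "sigma_coords M P X (- {k})"
    by (rule finite_measure_subalgebra_sigma_coords)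
  show ?thesis
    using assms(1) E.real_cond_exp_cong[OF assms]
    unfolding D_coord_def by eventually_elim simp
qed

text \<open>F and G agree with f(X) and g(X) only almost everywhere, which conditional expectation
  respects. For G = F the identity evaluates the mean square of a resampling difference.\<close>

lemma integral_representative_diff_mult:
  assumes F: "F \<in> L2_space P" "is_representative M P X F f"
    and G: "G \<in> L2_space P" "is_representative M P X G g"
  shows "(\<integral>\<omega>. (f (replace_coord X X' k \<omega>) - f (X \<omega>)) * (g (replace_coord X X' k \<omega>) - g (X \<omega>)) \<partial>P) =
    2 * (\<integral>\<omega>. D_coord M P X k F \<omega> * D_coord M P X k G \<omega> \<partial>P)"
proof -
  have f: "f \<in> L2_space (PiM UNIV M)" and g: "g \<in> L2_space (PiM UNIV M)"
    and F_f: "AE \<omega> in P. F \<omega> = f (X \<omega>)" and G_g: "AE \<omega> in P. G \<omega> = g (X \<omega>)"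
    using F G by (simp_all add: is_representative_def)
  note [measurable] = f[THEN L2_space_measurable] g[THEN L2_space_measurable]
    F(1)[THEN L2_space_measurable] G(1)[THEN L2_space_measurable]
  have "AE \<omega> in P. D_coord M P X k F \<omega> = D_coord M P X k (\<lambda>\<omega>. f (X \<omega>)) \<omega>"
    using F_f by (rule D_coord_cong_AE) measurable
  moreover have "AE \<omega> in P. D_coord M P X k G \<omega> = D_coord M P X k (\<lambda>\<omega>. g (X \<omega>)) \<omega>"
    using G_g by (rule D_coord_cong_AE) measurable
  ultimately have "AE \<omega> in P. D_coord M P X k (\<lambda>\<omega>. f (X \<omega>)) \<omega> * D_coord M P X k (\<lambda>\<omega>. g (X \<omega>)) \<omega> =
      D_coord M P X k F \<omega> * D_coord M P X k G \<omega>"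
    by eventually_elim simp
  then have "(\<integral>\<omega>. D_coord M P X k (\<lambda>\<omega>. f (X \<omega>)) \<omega> * D_coord M P X k (\<lambda>\<omega>. g (X \<omega>)) \<omega> \<partial>P) =
      (\<integral>\<omega>. D_coord M P X k F \<omega> * D_coord M P X k G \<omega> \<partial>P)"
    by (intro integral_cong_AE) measurable
  then show ?thesis
    using integral_replace_coord_diff_mult[OF f g] by simp
qed

lemma integral_Gamma0:
  assumes F: "F \<in> dom_D M P X" and G: "G \<in> dom_D M P X"
  shows "(\<integral>\<omega>. Gamma0 M P X X' F G \<omega> \<partial>P) =
    (\<Sum>k. \<integral>\<omega>. D_coord M P X k F \<omega> * D_coord M P X k G \<omega> \<partial>P)"
proof -
  interpret E: finite_measure_subalgebra P "sigma_X M P X"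
    by (rule finite_measure_subalgebra_sigma_X)
  define f where "f = representative M P X F"
  define g where "g = representative M P X G"
  have F': "F \<in> L2_space P" "is_representative M P X F f"
    and G': "G \<in> L2_space P" "is_representative M P X G g"
    using dom_D_L2[OF F] dom_D_L2[OF G] is_representative_representative
    by (auto simp: L2_space_P_X_iff f_def g_def)
  then have f: "f \<in> L2_space (PiM UNIV M)" and g: "g \<in> L2_space (PiM UNIV M)"
    by (simp_all add: is_representative_def)
  define h where "h k \<omega> = (f (replace_coord X X' k \<omega>) - f (X \<omega>)) * (g (replace_coord X X' k \<omega>) - g (X \<omega>))" for k \<omega>
  have int_h: "integrable P (h k)" for k
    unfolding h_def using f g by (intro L2_space_integrable_mult replace_coord_diff_L2)
  note int = E.real_cond_exp_int[OF int_h]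
  \<comment> \<open>The domination behind exchanging sum and integral: contraction removes the
    conditioning, a product is bounded by a sum of squares, and the diagonal cases of the resampling
    identity evaluate these squares.\<close>
  have sum: "summable (\<lambda>k. \<integral>\<omega>. \<bar>real_cond_exp P (sigma_X M P X) (h k) \<omega>\<bar> \<partial>P)"
  proof (rule summable_comparison_test')
    show "summable (\<lambda>k. 2 * (\<integral>\<omega>. (D_coord M P X k F \<omega>)\<^sup>2 \<partial>P) + 2 * (\<integral>\<omega>. (D_coord M P X k G \<omega>)\<^sup>2 \<partial>P))"
      using F G by (intro summable_add summable_mult summable_D_coord_square)
    fix k
    have "(\<integral>\<omega>. \<bar>real_cond_exp P (sigma_X M P X) (h k) \<omega>\<bar> \<partial>P) \<le> (\<integral>\<omega>. \<bar>h k \<omega>\<bar> \<partial>P)"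
      using int_h by (rule E.integral_abs_cond_exp_le)
    also have "\<dots> \<le> (\<integral>\<omega>. (f (replace_coord X X' k \<omega>) - f (X \<omega>))\<^sup>2 \<partial>P) + (\<integral>\<omega>. (g (replace_coord X X' k \<omega>) - g (X \<omega>))\<^sup>2 \<partial>P)"
      unfolding h_def using f g by (intro abs_integral_mult_le replace_coord_diff_L2)
    also have "\<dots> = 2 * (\<integral>\<omega>. (D_coord M P X k F \<omega>)\<^sup>2 \<partial>P) + 2 * (\<integral>\<omega>. (D_coord M P X k G \<omega>)\<^sup>2 \<partial>P)"
      unfolding power2_eq_square integral_representative_diff_mult[OF F' F'] integral_representative_diff_mult[OF G' G'] ..
    finally show "norm (\<integral>\<omega>. \<bar>real_cond_exp P (sigma_X M P X) (h k) \<omega>\<bar> \<partial>P) \<le>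
        2 * (\<integral>\<omega>. (D_coord M P X k F \<omega>)\<^sup>2 \<partial>P) + 2 * (\<integral>\<omega>. (D_coord M P X k G \<omega>)\<^sup>2 \<partial>P)"
      by simp
  qed
  have AE_sum: "AE \<omega> in P. summable (\<lambda>k. norm (real_cond_exp P (sigma_X M P X) (h k) \<omega>))"
    using AE_summable_abs[OF int(1) sum] by simp
  \<comment> \<open>Taking expectations removes the conditioning on X, so the resampling identity
    applies term by term.\<close>
  have int_c: "(\<integral>\<omega>. real_cond_exp P (sigma_X M P X) (h k) \<omega> \<partial>P) =
      2 * (\<integral>\<omega>. D_coord M P X k F \<omega> * D_coord M P X k G \<omega> \<partial>P)" for k
    using integral_representative_diff_mult[OF F' G'] by (simp add: int(2) h_def)
  have "(\<lambda>k. 2 * (\<integral>\<omega>. D_coord M P X k F \<omega> * D_coord M P X k G \<omega> \<partial>P))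
      sums (\<integral>\<omega>. (\<Sum>k. real_cond_exp P (sigma_X M P X) (h k) \<omega>) \<partial>P)"
    using sums_integral[OF int(1) AE_sum] sum by (simp add: int_c)
  from sums_mult[OF this, of "1/2"]
  have "(\<lambda>k. \<integral>\<omega>. D_coord M P X k F \<omega> * D_coord M P X k G \<omega> \<partial>P)
      sums (1/2 * (\<integral>\<omega>. (\<Sum>k. real_cond_exp P (sigma_X M P X) (h k) \<omega>) \<partial>P))"
    by simp
  moreover have "(\<integral>\<omega>. Gamma0 M P X X' F G \<omega> \<partial>P) =
      1/2 * (\<integral>\<omega>. (\<Sum>k. real_cond_exp P (sigma_X M P X) (h k) \<omega>) \<partial>P)"
    by (simp add: Gamma0_def Let_def h_def[abs_def] f_def g_def)
  ultimately show ?thesis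
    by (simp add: sums_iff)
qed

end

theorem proposition2p18:
  fixes M :: "nat \<Rightarrow> 'a measure"
    and P :: "'w measure"
    and X X' :: "'w \<Rightarrow> nat \<Rightarrow> 'a"
    and F G :: "'w \<Rightarrow> real"
  assumes "\<And>n. prob_space (M n)"
    and "prob_space P"
    and "X \<in> P \<rightarrow>\<^sub>M PiM UNIV M" and "distr P (PiM UNIV M) X = PiM UNIV M"
    and "X' \<in> P \<rightarrow>\<^sub>M PiM UNIV M" and "distr P (PiM UNIV M) X' = PiM UNIV M"
    and "prob_space.indep_var P (PiM UNIV M) X (PiM UNIV M) X'"
    and "F \<in> dom_D M P X"
    and "G \<in> dom_L M P X"
  shows "(\<integral>\<omega>. F \<omega> * OU_generator M P X G \<omega> \<partial>P) = - (\<integral>\<omega>. Gamma0 M P X X' F G \<omega> \<partial>P)"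
proof -
  interpret prob_space P by fact
  interpret coord_sequence_copy P M X X'
    by (intro coord_sequence_copy.intro coord_sequence.intro coord_sequence_axioms.intro
        coord_sequence_copy_axioms.intro; fact assms)
  show ?thesis
    using integral_mult_OU_generator[OF assms(8,9)] integral_Gamma0[OF assms(8)] assms(9)
    by (simp add: dom_L_def)
qed

end
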